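(* Let $n\geq 2$, let $k$ be an arbitrary field with algebraic closure $\overline k$, and let $\underline x=(x_1,\ldots,x_n)$. Let $\mathcal S=\{a_1,\ldots,a_t\}\subset k$ be a finite subset (with $a_1,\ldots,a_t$ distinct), let $a_0\in\overline k\setminus\mathcal S$ be separable over $k$, and let $V\in k[\underline x]$, $V\neq 0$. Let $w_0,\ldots,w_t\in k[\underline x]$ be $t+1$ nonzero polynomials with $w_0=1$. Assume that $(w_i)+(w_j)=k[\underline x]$ for $i\neq j$ and that each $w_i$ is relatively prime to $V$. Then there is an integer $d_0$, depending on $\mathcal S,a_0,V,w_1,\ldots,w_t$, such that for all integers $d_1,\ldots,d_n$ larger than $d_0$ there is a polynomial $U\in k[\underline x]$ such that these three conclusions hold: (a) $U-a_iV=w_iH_i$ with $H_i\in k[\underline x]$ irreducible in $k(a_0)[\underline x]$ and not dividing $w_i$, $i=1,\ldots,t$; (b) $\deg(U-a_0V)=\max(\deg(U),\deg(V))$; (c) $\deg_{x_i}(U)=d_i$, $i=1,\ldots,n$.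
   Context: $\deg$ denotes total degree in $\underline x$; $(w)$ denotes the ideal of $k[\underline x]$ generated by $w$. *)

theory Defs
  imports
    "HOL-Library.Cardinality"
    "HOL-Library.Poly_Mapping"
    "HOL-Algebra.Generated_Fields"
    "HOL-Algebra.Ring_Divisibility"
    "HOL-Algebra.Algebraic_Closure_Type"
begin

text \<open>Polynomials over \<open>'a\<close> in the variables \<open>x\<^sub>i\<close>, \<open>i :: 'n\<close>: finitely supported maps from
  exponent vectors to coefficients, multiplied by convolution.\<close>

type_synonym ('n, 'a) mpoly = "('n \<Rightarrow>\<^sub>0 nat) \<Rightarrow>\<^sub>0 'a"

abbreviation const_poly :: "'a::zero \<Rightarrow> ('n, 'a) mpoly"
  where "const_poly c \<equiv> Poly_Mapping.single 0 c"

text \<open>Both degrees of the zero polynomial are \<open>0\<close>.\<close>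

definition total_degree :: "('n::finite, 'a::zero) mpoly \<Rightarrow> nat"
  where "total_degree p =
    Max (insert 0 ((\<lambda>m. \<Sum>i\<in>UNIV. Poly_Mapping.lookup m i) ` Poly_Mapping.keys p))"

definition degree_in :: "'n \<Rightarrow> ('n, 'a::zero) mpoly \<Rightarrow> nat"
  where "degree_in i p = Max (insert 0 ((\<lambda>m. Poly_Mapping.lookup m i) ` Poly_Mapping.keys p))"

text \<open>The inclusion of \<open>k[x]\<close> into the polynomials over the algebraic closure of \<open>k\<close>.\<close>

definition to_ac_poly :: "('n, 'k::field) mpoly \<Rightarrow> ('n, 'k alg_closure) mpoly"
  where "to_ac_poly p = Poly_Mapping.map to_ac p"

text \<open>The library's \<^const>\<open>coprime\<close> is only available in class \<^class>\<open>algebraic_semidom\<close>, of which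
  this polynomial type is not an instance; the definition is the same.\<close>

definition rel_prime :: "'a::comm_semiring_1 \<Rightarrow> 'a \<Rightarrow> bool"
  where "rel_prime p q \<longleftrightarrow> (\<forall>c. c dvd p \<longrightarrow> c dvd q \<longrightarrow> c dvd 1)"

text \<open>The polynomial \<open>m\<close> is the minimal polynomial of \<open>a\<close> over \<open>k\<close>; separability means that it
  has only simple roots in the algebraic closure.\<close>

definition separable_element :: "'k::field alg_closure \<Rightarrow> bool"
  where "separable_element a \<longleftrightarrow>
    (\<exists>m :: 'k poly. Factorial_Ring.irreducible m \<and> lead_coeff m = 1 \<and>
       poly (map_poly to_ac m) a = 0 \<and> rsquarefree (map_poly to_ac m))"

text \<open>The field \<open>k(a)\<close>, as a subset of the algebraic closure.\<close>

definition adjoin :: "'k::field alg_closure \<Rightarrow> 'k alg_closure set"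
  where "adjoin a = generate_field ring_of_type_algebra (insert a (range to_ac))"

text \<open>The ring \<open>K[x]\<close> for a subfield \<open>K\<close> of \<open>'a\<close>.\<close>

definition poly_ring_over :: "'a::comm_ring_1 set \<Rightarrow> ('n, 'a) mpoly ring"
  where "poly_ring_over K = ring_of_type_algebra\<lparr>carrier := {p. range (Poly_Mapping.lookup p) \<subseteq> K}\<rparr>"

end

theory Submission
  imports Defs
begin

text \<open>By the Chinese remainder theorem choose \<open>u\<close> with \<open>u - a\<^sub>i V = w\<^sub>i P\<^sub>i\<close> for all \<open>i\<close>. Adding to \<open>u\<close> a
  multiple \<open>A W\<close> of \<open>W = w\<^sub>1 \<dots> w\<^sub>t\<close> replaces \<open>P\<^sub>i\<close> by \<open>H\<^sub>i = P\<^sub>i + A Q\<^sub>i\<close> with \<open>Q\<^sub>i = W / w\<^sub>i\<close>. The hypotheses make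
  \<open>P\<^sub>i\<close> and \<open>Q\<^sub>i\<close> coprime, also over the algebraic closure. Let \<open>S\<close> be the product of the \<open>P\<^sub>i\<close>. A
  triangular substitution \<open>x\<^sub>i \<mapsto> x\<^sub>i + y ^ e\<^sub>i\<close>, with \<open>y\<close> one of the variables, makes \<open>S\<close> and all
  \<open>Q\<^sub>i\<close> monic in \<open>y\<close>, up to constants. Take
  \<open>A = (1 + S Z) T\<close>, where \<open>Z\<close> is a monomial that adjusts the degrees and \<open>T\<close> becomes
  \<open>y + x ^ \<alpha>\<close> after the substitution, with \<open>\<alpha>\<close> large and independent of \<open>Z\<close>. The polynomial
  \<open>P\<^sub>i + Q\<^sub>i (1 + S Z) (y + x ^ \<alpha>)\<close> has one root \<open>y\<close> of large degree in \<open>x\<close>, and all its other roots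
  have bounded degree. A factor \<open>g\<close> with only roots of bounded degree divides
  \<open>Q\<^sub>i (1 + S Z)\<close> because \<open>\<alpha>\<close> is large, hence it divides \<open>P\<^sub>i\<close> and \<open>S\<close>, hence also \<open>Q\<^sub>i\<close>, and so it is
  constant.\<close>

subsection \<open>A polynomial with one root of large degree\<close>

text \<open>An abstract total degree. Later \<open>\<delta>\<close> is the total degree of
  polynomials over a field, where the nonzero elements of degree 0 are the nonzero
  constants.\<close>

locale graded_domain =
  fixes \<delta> :: "'b::idom \<Rightarrow> nat"
  assumes deg_mult: "\<lbrakk>a \<noteq> 0; b \<noteq> 0\<rbrakk> \<Longrightarrow> \<delta> (a * b) = \<delta> a + \<delta> b"
    and deg_add: "\<delta> (a + b) \<le> max (\<delta> a) (\<delta> b)"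
    and deg_0_unit: "\<lbrakk>a \<noteq> 0; \<delta> a = 0\<rbrakk> \<Longrightarrow> a dvd 1"
begin

lemma deg_one: "\<delta> 1 = 0"
  using deg_mult[of 1 1] by simp

lemma deg_dvd: "\<lbrakk>a dvd b; b \<noteq> 0\<rbrakk> \<Longrightarrow> \<delta> a \<le> \<delta> b"
  by (auto elim!: dvdE simp: deg_mult)

lemma deg_unit: "a dvd 1 \<Longrightarrow> \<delta> a = 0"
  using deg_dvd[of a 1] by (simp add: deg_one)

lemma deg_uminus: "\<delta> (- a) = \<delta> a"
proof (cases "a = 0")
  case False
  have "\<delta> (-1) = 0" by (rule deg_unit) simp
  with False deg_mult[of "-1" a] show ?thesis by simp
qed simp

text \<open>The offset \<open>k\<close> stands on the left, because \<open>C - k\<close> would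
  truncate at 0. The element 0 counts as having degree minus infinity.\<close>

definition deg_le :: "nat \<Rightarrow> nat \<Rightarrow> 'b \<Rightarrow> bool"
  where "deg_le k C a \<longleftrightarrow> (a \<noteq> 0 \<longrightarrow> \<delta> a + k \<le> C)"

lemma deg_le_0 [simp]: "deg_le k C 0"
  by (simp add: deg_le_def)

lemma deg_le_add: "\<lbrakk>deg_le k C a; deg_le k C b\<rbrakk> \<Longrightarrow> deg_le k C (a + b)"
  unfolding deg_le_def using deg_add[of a b] by (cases "a = 0"; cases "b = 0") auto

lemma deg_le_uminus: "deg_le k C (- a) \<longleftrightarrow> deg_le k C a"
  by (simp add: deg_le_def deg_uminus)

lemma deg_le_diff: "\<lbrakk>deg_le k C a; deg_le k C b\<rbrakk> \<Longrightarrow> deg_le k C (a - b)"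
  using deg_le_add[of k C a "- b"] by (simp add: deg_le_uminus)

lemma deg_le_mult: "\<lbrakk>deg_le k C a; deg_le l D b; m \<le> k + l; C + D \<le> E\<rbrakk> \<Longrightarrow> deg_le m E (a * b)"
  unfolding deg_le_def using deg_mult[of a b] by auto

lemma deg_le_sum: "(\<And>i. i \<in> I \<Longrightarrow> deg_le k C (f i)) \<Longrightarrow> deg_le k C (sum f I)"
  by (induction I rule: infinite_finite_induct) (auto intro: deg_le_add)

lemma deg_le_mono: "\<lbrakk>deg_le k C a; l \<le> k; C \<le> D\<rbrakk> \<Longrightarrow> deg_le l D a"
  by (auto simp: deg_le_def)

text \<open>The \<open>Suc\<close> makes the degree of \<open>b\<close> strictly smaller than that
  of \<open>a\<close>, so the leading part of \<open>a\<close> cannot cancel.\<close>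

lemma deg_le_dominant:
  assumes "a \<noteq> 0" "\<delta> a + k = C" "deg_le (Suc k) C b"
  shows "a + b \<noteq> 0" "\<delta> (a + b) + k = C"
proof -
  have b: "\<delta> b < \<delta> a" if "b \<noteq> 0" using assms that by (auto simp: deg_le_def)
  show "a + b \<noteq> 0"
  proof
    assume "a + b = 0"
    then have "b = - a" by (simp add: add_eq_0_iff)
    with b assms(1) show False by (simp add: deg_uminus)
  qed
  have "\<delta> (a + b) = \<delta> a"
  proof (cases "b = 0")
    case False
    from deg_add[of "a + b" "- b"] deg_add[of a b] b[OF False] show ?thesis
      by (auto simp: deg_uminus max_def split: if_splits)
  qed simp
  with assms(2) show "\<delta> (a + b) + k = C" by simp
qed

section \<open>Weights on univariate polynomials, with the variable given degree
  \<open>\<kappa>\<close>\<close>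

definition weight_le :: "nat \<Rightarrow> nat \<Rightarrow> 'b poly \<Rightarrow> bool"
  where "weight_le \<kappa> C f \<longleftrightarrow> (\<forall>i. deg_le (\<kappa> * i) C (coeff f i))"

lemma weight_leD: "weight_le \<kappa> C f \<Longrightarrow> deg_le (\<kappa> * i) C (coeff f i)"
  by (simp add: weight_le_def)

lemma weight_le_0 [simp]: "weight_le \<kappa> C 0"
  by (simp add: weight_le_def)

lemma weight_le_mono: "\<lbrakk>weight_le \<kappa> C f; C \<le> D\<rbrakk> \<Longrightarrow> weight_le \<kappa> D f"
  by (auto simp: weight_le_def intro: deg_le_mono)

lemma weight_le_add: "\<lbrakk>weight_le \<kappa> C f; weight_le \<kappa> C g\<rbrakk> \<Longrightarrow> weight_le \<kappa> C (f + g)"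
  by (auto simp: weight_le_def intro: deg_le_add)

lemma weight_le_diff: "\<lbrakk>weight_le \<kappa> C f; weight_le \<kappa> C g\<rbrakk> \<Longrightarrow> weight_le \<kappa> C (f - g)"
  by (auto simp: weight_le_def intro: deg_le_diff)

lemma weight_le_mult:
  assumes "weight_le \<kappa> C f" "weight_le \<kappa> D g"
  shows "weight_le \<kappa> (C + D) (f * g)"
  unfolding weight_le_def coeff_mult
proof (intro allI deg_le_sum)
  fix n i :: nat assume "i \<in> {..n}"
  then have "\<kappa> * n \<le> \<kappa> * i + \<kappa> * (n - i)" by (simp flip: add_mult_distrib2)
  then show "deg_le (\<kappa> * n) (C + D) (coeff f i * coeff g (n - i))"
    using assms by (intro deg_le_mult) (auto simp: weight_le_def)
qed

lemma weight_le_exists: "\<exists>C. weight_le \<kappa> C f"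
proof
  show "weight_le \<kappa> (Max ((\<lambda>i. \<delta> (coeff f i) + \<kappa> * i) ` {..degree f})) f"
    unfolding weight_le_def deg_le_def by (auto intro!: Max_ge dest: le_degree)
qed

text \<open>The maximal weight \<open>W\<close> and the last index \<open>i\<close> at which it is
  attained, an end of a Newton polygon edge. Intuitively \<open>i\<close> counts the roots of degree
  at most \<open>\<kappa>\<close>.\<close>

definition top_weight :: "nat \<Rightarrow> 'b poly \<Rightarrow> nat \<Rightarrow> nat \<Rightarrow> bool"
  where "top_weight \<kappa> f W i \<longleftrightarrow> coeff f i \<noteq> 0 \<and> \<delta> (coeff f i) + \<kappa> * i = W \<and> weight_le \<kappa> W f \<and>
    (\<forall>j>i. deg_le (Suc (\<kappa> * j)) W (coeff f j))"

lemma top_weight_unique: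
  assumes "top_weight \<kappa> f W i" "top_weight \<kappa> f W' i'"
  shows "W = W'" "i = i'"
proof -
  show W: "W = W'"
    using assms weight_leD[of \<kappa> W f i'] weight_leD[of \<kappa> W' f i] by (auto simp: top_weight_def deg_le_def)
  show "i = i'"
    using assms W by (cases i i' rule: linorder_cases) (auto simp: top_weight_def deg_le_def)
qed

lemma top_weight_exists:
  assumes "f \<noteq> 0"
  shows "\<exists>W i. top_weight \<kappa> f W i"
proof -
  define S where "S = {i. coeff f i \<noteq> 0}"
  have fin: "finite S" unfolding S_def
    by (rule finite_subset[of _ "{..degree f}"]) (auto intro: le_degree)
  have "S \<noteq> {}" using assms by (auto simp: S_def poly_eq_iff)
  define w where "w i = \<delta> (coeff f i) + \<kappa> * i" for i
  define W where "W = Max (w ` S)"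
  define T where "T = {i\<in>S. w i = W}"
  have "W \<in> w ` S" unfolding W_def using fin \<open>S \<noteq> {}\<close> by (intro Max_in) auto
  then have T: "finite T" "T \<noteq> {}" using fin by (auto simp: T_def)
  have le: "w j \<le> W" if "j \<in> S" for j using that fin by (auto simp: W_def)
  have "Max T \<in> T" using T by (rule Max_in)
  moreover have "w j < W" if "j \<in> S" "j > Max T" for j
    using le[OF that(1)] that T Max_ge[OF T(1), of j] by (auto simp: T_def le_less)
  moreover have "deg_le (\<kappa> * j) W (coeff f j)" for j
    using le[of j] by (simp add: deg_le_def S_def w_def)
  ultimately have "top_weight \<kappa> f W (Max T)"
    unfolding top_weight_def weight_le_def deg_le_def S_def T_def w_def by (simp add: Suc_le_eq)
  then show ?thesis by blast
qed

text \<open>The argument for leading terms, with weight in place of degree: in the coefficient at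
  \<open>i + j\<close> only the product of the two top coefficients reaches weight
  \<open>W + W'\<close>.\<close>

lemma top_weight_mult:
  assumes f: "top_weight \<kappa> f W i" and g: "top_weight \<kappa> g W' j"
  shows "top_weight \<kappa> (f * g) (W + W') (i + j)"
proof -
  have wf: "weight_le \<kappa> W f" and wg: "weight_le \<kappa> W' g" using f g by (auto simp: top_weight_def)
  \<comment> \<open>Every pair of indices with sum at least \<open>i + j\<close>, other than
    \<open>(i, j)\<close> itself, passes one of the two top indices, and beyond these the weight
    bound is strict.\<close>
  have strict: "deg_le (Suc (\<kappa> * n)) (W + W') (coeff f a * coeff g (n - a))"
    if "a \<le> n" "n \<ge> i + j" "a = i \<longrightarrow> n \<noteq> i + j" for a n :: nat
  proof -
    have eq: "\<kappa> * n = \<kappa> * a + \<kappa> * (n - a)" using that by (simp flip: add_mult_distrib2)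
    have "a > i \<or> n - a > j" using that by auto
    then consider "a > i" | "n - a > j" by blast
    then show ?thesis
    proof cases
      case 1
      then have "deg_le (Suc (\<kappa> * a)) W (coeff f a)" using f by (auto simp: top_weight_def)
      then show ?thesis by (rule deg_le_mult[OF _ weight_leD[OF wg]]) (use eq in auto)
    next
      case 2
      then have "deg_le (Suc (\<kappa> * (n - a))) W' (coeff g (n - a))" using g by (auto simp: top_weight_def)
      then show ?thesis by (rule deg_le_mult[OF weight_leD[OF wf]]) (use eq in auto)
    qed
  qed
  have high: "deg_le (Suc (\<kappa> * n)) (W + W') (coeff (f * g) n)" if "n > i + j" for n
    unfolding coeff_mult using that by (intro deg_le_sum strict) auto
  have split: "coeff (f * g) (i + j) = coeff f i * coeff g j +
      (\<Sum>a\<in>{..i+j}-{i}. coeff f a * coeff g (i + j - a))"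
    unfolding coeff_mult by (subst sum.remove[of _ i]) auto
  have rest: "deg_le (Suc (\<kappa> * (i + j))) (W + W') (\<Sum>a\<in>{..i+j}-{i}. coeff f a * coeff g (i + j - a))"
    by (intro deg_le_sum strict) auto
  have main: "coeff f i * coeff g j \<noteq> 0" "\<delta> (coeff f i * coeff g j) + \<kappa> * (i + j) = W + W'"
    using f g by (auto simp: top_weight_def deg_mult algebra_simps)
  show ?thesis
    unfolding top_weight_def split using deg_le_dominant[OF main rest] weight_le_mult[OF wf wg] high by blast
qed

text \<open>The leading coefficient is a unit and all roots have degree at most \<open>\<kappa>\<close>.\<close>

definition good :: "nat \<Rightarrow> 'b poly \<Rightarrow> bool"
  where "good \<kappa> f \<longleftrightarrow> lead_coeff f dvd 1 \<and> weight_le \<kappa> (\<kappa> * degree f) f"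

lemma good_nonzero: "good \<kappa> f \<Longrightarrow> f \<noteq> 0"
  by (auto simp: good_def)

lemma good_mult: "\<lbrakk>good \<kappa> f; good \<kappa> g\<rbrakk> \<Longrightarrow> good \<kappa> (f * g)"
  using weight_le_mult[of \<kappa> "\<kappa> * degree f" f "\<kappa> * degree g" g]
  using lead_coeff_mult[of f g] mult_dvd_mono[of "lead_coeff f" 1 "lead_coeff g" 1]
  by (cases "f = 0 \<or> g = 0") (auto simp: good_def degree_mult_eq add_mult_distrib2)

lemma good_1: "good \<kappa> 1"
  by (simp add: good_def weight_le_def deg_le_def deg_one)

lemma good_power: "good \<kappa> f \<Longrightarrow> good \<kappa> (f ^ n)"
  by (induction n) (auto intro: good_1 good_mult)

lemma good_prod: "(\<And>i. i \<in> I \<Longrightarrow> good \<kappa> (f i)) \<Longrightarrow> good \<kappa> (prod f I)"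
  by (induction I rule: infinite_finite_induct) (auto intro: good_1 good_mult)

lemma good_1_plus:
  assumes "good \<kappa> f" "degree f > 0"
  shows "good \<kappa> (1 + f)"
proof -
  have "degree (1 + f) = degree f" using assms(2) by (simp add: degree_add_eq_right)
  moreover have "weight_le \<kappa> (\<kappa> * degree f) 1" by (auto simp: weight_le_def deg_le_def deg_one)
  ultimately show ?thesis using assms weight_le_add by (auto simp: good_def)
qed

text \<open>Raising the slope adds \<open>(\<mu> - \<kappa>) * i\<close> on the left and the larger
  \<open>(\<mu> - \<kappa>) * degree f\<close> on the right.\<close>

lemma good_mono:
  assumes "good \<kappa> f" "\<kappa> \<le> \<mu>"
  shows "good \<mu> f"
proof -
  have "\<delta> (coeff f i) + \<mu> * i \<le> \<mu> * degree f" if "coeff f i \<noteq> 0" for i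
  proof -
    have "\<delta> (coeff f i) + \<kappa> * i \<le> \<kappa> * degree f"
      using assms(1) that by (auto simp: good_def weight_le_def deg_le_def)
    moreover have "(\<mu> - \<kappa>) * i \<le> (\<mu> - \<kappa>) * degree f" using that le_degree[of f i] by simp
    ultimately have "\<delta> (coeff f i) + (\<kappa> + (\<mu> - \<kappa>)) * i \<le> (\<kappa> + (\<mu> - \<kappa>)) * degree f"
      unfolding add_mult_distrib by linarith
    then show ?thesis using assms(2) by simp
  qed
  then show ?thesis using assms(1) by (auto simp: good_def weight_le_def deg_le_def)
qed

lemma good_exists:
  assumes "lead_coeff f dvd 1"
  shows "\<exists>\<kappa>. good \<kappa> f"
proof
  \<comment> \<open>Each coefficient below the leading one is at least one index away from the top,
    so this slope absorbs its degree; the leading one is a unit of degree 0.\<close>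
  define \<kappa> where "\<kappa> = Max ((\<lambda>i. \<delta> (coeff f i)) ` {..degree f})"
  have "\<delta> (coeff f i) + \<kappa> * i \<le> \<kappa> * degree f" if "coeff f i \<noteq> 0" for i
  proof (cases "i = degree f")
    case True
    then show ?thesis using deg_unit[OF assms] by simp
  next
    case False
    with that have i: "Suc i \<le> degree f" using le_degree[of f i] by linarith
    then have "\<delta> (coeff f i) \<le> \<kappa>" unfolding \<kappa>_def by (intro Max_ge) auto
    then have "\<delta> (coeff f i) + \<kappa> * i \<le> \<kappa> * Suc i" by simp
    also have "\<dots> \<le> \<kappa> * degree f" using i by (rule mult_le_mono2)
    finally show ?thesis .
  qed
  then show "good \<kappa> f" using assms by (auto simp: good_def weight_le_def deg_le_def)
qed

text \<open>In the usual long division each subtracted multiple of \<open>g\<close> has at most the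
  weight of the leading term that it cancels, so the weight bound survives.\<close>

lemma good_division:
  assumes g: "good \<kappa> g" and "weight_le \<kappa> C f"
  shows "\<exists>q r. f = q * g + r \<and> weight_le \<kappa> C r \<and> (r = 0 \<or> degree r < degree g)"
  using assms(2)
proof (induction "degree f" arbitrary: f rule: less_induct)
  case less
  show ?case
  proof (cases "f = 0 \<or> degree f < degree g")
    case True
    then show ?thesis using less(2) by (intro exI[of _ 0] exI[of _ f]) auto
  next
    case False
    have "lead_coeff g dvd 1" using g by (simp add: good_def)
    then obtain u where u: "lead_coeff g * u = 1" by (metis dvd_def)
    define n where "n = degree f - degree g"
    define h where "h = monom (lead_coeff f * u) n"
    have u0: "u \<noteq> 0" using u by auto
    have fu: "lead_coeff f * u \<noteq> 0" using False u0 by simp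
    have degh: "degree h = n" using fu by (simp add: h_def degree_monom_eq)
    have "h \<noteq> 0" using fu by (simp add: h_def)
    then have deg_hg: "degree (h * g) = degree f"
      using False good_nonzero[OF g] degh by (simp add: degree_mult_eq n_def)
    have lc: "lead_coeff (h * g) = lead_coeff f"
      using u degh using fu by (simp add: lead_coeff_mult h_def degree_monom_eq mult.assoc mult.commute)
    have du: "\<delta> u = 0" using u by (intro deg_unit dvdI[of _ _ "lead_coeff g"]) (simp add: mult.commute)
    have "\<delta> (lead_coeff f) + \<kappa> * degree f \<le> C" using less(2) False by (auto simp: weight_le_def deg_le_def)
    then have "weight_le \<kappa> (C - \<kappa> * degree g) h"
      using False du u0
      by (auto simp: weight_le_def deg_le_def h_def deg_mult n_def diff_mult_distrib2 less_imp_le)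
    then have "weight_le \<kappa> (C - \<kappa> * degree g + \<kappa> * degree g) (h * g)"
      using g by (intro weight_le_mult) (auto simp: good_def)
    \<comment> \<open>This shows that the subtraction \<open>C - \<kappa> * degree g\<close> above
      is not truncated.\<close>
    moreover have "\<kappa> * degree g \<le> C"
      using \<open>\<delta> (lead_coeff f) + \<kappa> * degree f \<le> C\<close> False
      by (meson add_leD2 le_trans mult_le_mono2 not_less)
    ultimately have weight_le: "weight_le \<kappa> C (f - h * g)" using less(2) by (auto intro: weight_le_diff)
    show ?thesis
    proof (cases "f - h * g = 0")
      case True
      then show ?thesis by (intro exI[of _ h] exI[of _ 0]) auto
    next
      case False
      have "coeff (f - h * g) (degree f) = 0" using lc deg_hg by simp
      moreover have "degree (f - h * g) \<le> degree f" using deg_hg by (simp add: degree_diff_le)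
      ultimately have "degree (f - h * g) < degree f"
        using False by (metis le_neq_implies_less leading_coeff_0_iff)
      from less(1)[OF this weight_le] obtain q r where
        "f - h * g = q * g + r" "weight_le \<kappa> C r" "r = 0 \<or> degree r < degree g" by blast
      then show ?thesis by (intro exI[of _ "h + q"] exI[of _ r]) (auto simp: algebra_simps)
    qed
  qed
qed

text \<open>The coefficient of maximal weight in \<open>f * g\<close> is the second from the top, so one of the two
  factors has all its roots of degree at most \<open>\<kappa>\<close>. Division by that factor then bounds \<open>\<delta> s\<close>,
  unless the factor divides \<open>Q\<close>.\<close>

theorem linear_factor_irreducible:
  assumes Q: "good \<kappa> Q" and P: "weight_le \<kappa> C P" "degree P \<le> degree Q"
    and s0: "s \<noteq> 0" and s: "\<kappa> < \<delta> s" "C < \<delta> s"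
    and cop: "\<And>g. \<lbrakk>g dvd P; g dvd Q\<rbrakk> \<Longrightarrow> g dvd 1"
    and fac: "P + Q * [:s, 1:] = f * g"
  shows "f dvd 1 \<or> g dvd 1"
proof -
  define D where "D = degree Q"
  define H where "H = P + Q * [:s, 1:]"
  have Q0: "Q \<noteq> 0" using Q by (rule good_nonzero)
  have coeff_H: "coeff H i = coeff P i + (s * coeff Q i + coeff (pCons 0 Q) i)" for i
    by (simp add: H_def)
  have "degree (Q * [:s, 1:]) = Suc D" using Q0 by (simp add: degree_mult_eq D_def del: mult_pCons_right)
  then have degH: "degree H = Suc D" using P(2) unfolding H_def D_def by (subst degree_add_eq_right) auto
  have lcH: "lead_coeff H = lead_coeff Q"
    unfolding degH using P(2) Q0 by (simp add: coeff_H D_def coeff_eq_0)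
  have dQ: "\<delta> (lead_coeff Q) = 0" using Q by (auto simp: good_def intro: deg_unit)
  have bQ: "deg_le (\<kappa> * i) (\<kappa> * D) (coeff Q i)" for i using Q by (auto simp: good_def D_def intro: weight_leD)
  have bP: "deg_le (Suc (\<kappa> * i)) (\<delta> s + \<kappa> * D) (coeff P i)" for i
    using s weight_leD[OF P(1), of i] by (auto simp: deg_le_def)
  have bX: "deg_le (Suc (\<kappa> * i)) (\<delta> s + \<kappa> * D) (coeff (pCons 0 Q) i)" for i
  proof (cases i)
    case (Suc j)
    then show ?thesis using bQ[of j] s by (auto simp: deg_le_def)
  qed simp
  have small: "deg_le (Suc (\<kappa> * i)) (\<delta> s + \<kappa> * D) (coeff (pCons 0 Q) i + coeff P i)" for i
    using bP bX by (rule deg_le_add[rotated])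
  have bsQ: "deg_le (\<kappa> * i) (\<delta> s + \<kappa> * D) (s * coeff Q i)" for i
    using bQ[of i] s0 by (auto simp: deg_le_def deg_mult)
  have "s * lead_coeff Q \<noteq> 0" "\<delta> (s * lead_coeff Q) + \<kappa> * D = \<delta> s + \<kappa> * D"
    using s0 Q0 dQ by (auto simp: deg_mult)
  from deg_le_dominant[OF this, of "coeff (pCons 0 Q) D + coeff P D"] small[of D]
  have mid: "coeff H D \<noteq> 0" "\<delta> (coeff H D) + \<kappa> * D = \<delta> s + \<kappa> * D"
    by (auto simp: coeff_H D_def algebra_simps)
  have "deg_le (\<kappa> * i) (\<delta> s + \<kappa> * D) (coeff H i)" for i
    using deg_le_add[OF bsQ[of i] deg_le_mono[OF small[of i] le_SucI[OF le_refl] le_refl]]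
    by (simp add: coeff_H add_ac)
  moreover have "deg_le (Suc (\<kappa> * i)) (\<delta> s + \<kappa> * D) (coeff H i)" if "i > D" for i
    using small[of i] that by (simp add: coeff_H D_def coeff_eq_0 algebra_simps)
  ultimately have topH: "top_weight \<kappa> H (\<delta> s + \<kappa> * D) D"
    using mid by (simp add: top_weight_def weight_le_def)
  have "H \<noteq> 0" using degH by auto
  then have fg0: "f \<noteq> 0" "g \<noteq> 0" using fac by (auto simp: H_def)
  obtain W1 i1 W2 i2 where t: "top_weight \<kappa> f W1 i1" "top_weight \<kappa> g W2 i2"
    using top_weight_exists fg0 by blast
  have "i1 + i2 = D"
    using top_weight_unique(2)[OF top_weight_mult[OF t], of "\<delta> s + \<kappa> * D" D] topH fac by (simp add: H_def)
  moreover have "degree f + degree g = Suc D"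
    using degH fac fg0 by (simp add: H_def degree_mult_eq)
  moreover have "i1 \<le> degree f" "i2 \<le> degree g" using t by (auto simp: top_weight_def intro: le_degree)
  \<comment> \<open>The top indices add up to \<open>D\<close> but the degrees to
    \<open>Suc D\<close>, so exactly one factor has its top index below its degree.\<close>
  ultimately have cases: "i1 = degree f \<or> i2 = degree g" by linarith
  have lc: "lead_coeff f * lead_coeff g dvd 1"
    using lcH fac Q by (metis H_def good_def lead_coeff_mult)
  have unit_lc: "lead_coeff f dvd 1" "lead_coeff g dvd 1" using lc by (auto dest: dvd_mult_left dvd_mult_right)
  \<comment> \<open>A factor whose top index equals its degree, with unit leading coefficient, is
    \<open>good\<close>, so division by it keeps weights under control.\<close>
  have key: "h dvd 1" if hH: "h dvd H" and topg: "top_weight \<kappa> h W (degree h)" and uh: "lead_coeff h dvd 1"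
    for h W
  proof (cases "degree h = 0")
    case True
    then show ?thesis using uh by (metis degree_eq_zeroE lead_coeff_pCons(2) is_unit_const_poly_iff degree_pCons_0 coeff_pCons_0)
  next
    case False
    define E where "E = degree h"
    have h: "good \<kappa> h"
      using topg uh deg_unit[OF uh] by (auto simp: good_def top_weight_def)
    from good_division[OF h, of "\<kappa> * D" Q] obtain q r where
      qr: "Q = q * h + r" "r = 0 \<or> degree r < degree h"
      using Q by (auto simp: good_def D_def)
    from good_division[OF h P(1)] obtain q' r' where
      qr': "P = q' * h + r'" "weight_le \<kappa> C r'" "r' = 0 \<or> degree r' < degree h" by blast
    \<comment> \<open>Reducing \<open>H\<close> modulo \<open>h\<close> leaves this expression of
      degree at most \<open>degree h\<close>; hence it is a multiple of \<open>h\<close> by an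
      element of the coefficient ring.\<close>
    have "h dvd r' + r * [:s, 1:]"
    proof -
      have "H = (q' + q * [:s, 1:]) * h + (r' + r * [:s, 1:])"
        unfolding H_def qr(1) qr'(1) by (simp add: algebra_simps del: mult_pCons_right)
      with hH show ?thesis by (metis dvd_add_right_iff dvd_triv_right)
    qed
    then obtain c where c: "r' + r * [:s, 1:] = c * h" by (metis dvd_def mult.commute)
    have "degree (r' + r * [:s, 1:]) \<le> E"
    proof (rule degree_add_le)
      show "degree r' \<le> E" using qr'(3) by (auto simp: E_def)
      show "degree (r * [:s, 1:]) \<le> E" using qr(2) degree_mult_le[of r "[:s, 1:]"] False
        by (auto simp: E_def)
    qed
    \<comment> \<open>Otherwise compare coefficients at the top index \<open>i\<close> of
      \<open>r\<close>: the term with \<open>s\<close> has weight \<open>\<delta> s + V\<close>, all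
      others at most \<open>max (\<kappa> + V) C\<close>, which contradicts the size of
      \<open>\<delta> s\<close>.\<close>
    have "r = 0"
    proof (rule ccontr)
      assume r0: "r \<noteq> 0"
      then have dr: "degree r < E" using qr by (auto simp: E_def)
      obtain V i where ti: "top_weight \<kappa> r V i" using top_weight_exists r0 by blast
      have wr: "weight_le \<kappa> V r" using ti by (simp add: top_weight_def)
      have "degree c = 0"
      proof (cases "c = 0")
        case False
        then have "degree c + E = degree (c * h)"
          using good_nonzero[OF h] by (simp add: degree_mult_eq E_def)
        with c \<open>degree (r' + r * [:s, 1:]) \<le> E\<close> show ?thesis by simp
      qed simp
      then obtain c0 where c0: "c = [:c0:]" by (metis degree_eq_zeroE)
      have ci: "coeff r' j + (s * coeff r j + coeff (pCons 0 r) j) = c0 * coeff h j" for j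
        using arg_cong[OF c, of "\<lambda>p. coeff p j"] by (simp add: c0)
      have "deg_le (\<kappa> * j) (\<kappa> + V) (coeff (pCons 0 r) j)" for j
        using weight_leD[OF wr, of "j - 1"] by (cases j) (auto simp: deg_le_def)
      note pc = this
      \<comment> \<open>At index \<open>E\<close> only \<open>coeff r e\<close> remains on the left,
        which expresses \<open>c0\<close> through \<open>r\<close> and so bounds its degree.\<close>
      obtain e where e: "E = Suc e" using dr by (cases E) auto
      have "coeff r' E = 0" "coeff r E = 0" using qr'(3) dr by (auto simp: E_def coeff_eq_0)
      then have "coeff r e = c0 * lead_coeff h" using ci[of E] by (simp add: e flip: E_def)
      then have "deg_le (\<kappa> * e) V (c0 * lead_coeff h)" using weight_leD[OF wr, of e] by simp
      then have bc0: "deg_le (\<kappa> * e) V c0"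
        using uh deg_unit[OF uh] by (cases "c0 = 0") (auto simp: deg_le_def deg_mult)
      have bh: "deg_le (\<kappa> * j) (\<kappa> * E) (coeff h j)" for j
        using h by (auto simp: good_def E_def intro: weight_leD)
      have "deg_le (\<kappa> * i) (\<kappa> + V) (c0 * coeff h i)"
      proof (cases "c0 = 0 \<or> coeff h i = 0")
        case False
        then show ?thesis using bc0 bh[of i] by (auto simp: deg_le_def deg_mult e)
      qed auto
      then have "deg_le (\<kappa> * i) (max (\<kappa> + V) C) (c0 * coeff h i - coeff (pCons 0 r) i - coeff r' i)"
        using pc[of i] weight_leD[OF qr'(2), of i] by (intro deg_le_diff) (auto intro: deg_le_mono)
      also have "c0 * coeff h i - coeff (pCons 0 r) i - coeff r' i = s * coeff r i"
        using ci[of i] by (simp add: algebra_simps)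
      finally show False using ti s s0 by (auto simp: top_weight_def deg_le_def deg_mult)
    qed
    with c have "r' = c * h" by simp
    then have "r' = 0"
      using qr'(3) good_nonzero[OF h] by (cases "c = 0") (auto simp: degree_mult_eq)
    then show ?thesis using cop qr(1) qr'(1) \<open>r = 0\<close> by simp
  qed
  from cases show ?thesis
    using key[of f W1] key[of g W2] t unit_lc fac by (auto simp: H_def)
qed

end

subsection \<open>Ring homomorphisms\<close>

locale rhom =
  fixes h :: "'a::comm_ring_1 \<Rightarrow> 'b::comm_ring_1"
  assumes add: "h (x + y) = h x + h y"
    and mult: "h (x * y) = h x * h y"
    and one: "h 1 = 1"
begin

lemma zero: "h 0 = 0"
  using add[of 0 0] by simp

lemma uminus: "h (- x) = - h x"
  using add[of x "- x"] by (simp add: zero eq_neg_iff_add_eq_0 add.commute)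

lemma diff: "h (x - y) = h x - h y"
  using add[of x "- y"] by (simp add: uminus)

lemma sum: "h (sum f I) = (\<Sum>i\<in>I. h (f i))"
  by (induction I rule: infinite_finite_induct) (auto simp: zero add)

lemma prod: "h (prod f I) = (\<Prod>i\<in>I. h (f i))"
  by (induction I rule: infinite_finite_induct) (auto simp: one mult)

lemma power: "h (x ^ n) = h x ^ n"
  by (induction n) (auto simp: one mult)

lemma dvd: "x dvd y \<Longrightarrow> h x dvd h y"
  by (auto elim!: dvdE simp: mult)

end

lemma rhom_comp: "\<lbrakk>rhom f; rhom g\<rbrakk> \<Longrightarrow> rhom (\<lambda>x. f (g x))"
  by (simp add: rhom_def)

lemma rhom_id: "rhom (\<lambda>x. x)"
  by (simp add: rhom_def)

lemma rhom_const_poly: "rhom const_poly"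
  by unfold_locales (auto simp: single_add mult_single)

lemma rhom_pCons: "rhom (\<lambda>c. [:c:])"
  by unfold_locales (auto simp: one_pCons)

lemma map_poly_mult_rhom:
  assumes "rhom h"
  shows "map_poly h (p * q) = map_poly h p * map_poly h q"
proof (rule poly_eqI)
  interpret rhom h by fact
  show "coeff (map_poly h (p * q)) n = coeff (map_poly h p * map_poly h q) n" for n
    by (simp add: coeff_map_poly coeff_mult zero mult sum)
qed

lemma rhom_map_poly:
  assumes "rhom h"
  shows "rhom (map_poly h)"
proof -
  interpret rhom h by fact
  show ?thesis
    by (standard; (rule poly_eqI)?)
      (auto simp: coeff_map_poly zero add one map_poly_mult_rhom[OF assms] coeff_1)
qed

lemma rhom_poly: "rhom (\<lambda>p. poly p x)"
  by unfold_locales auto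

lemma rhom_poly_ext:
  fixes g h :: "'a::comm_ring_1 poly \<Rightarrow> 'b::comm_ring_1"
  assumes "rhom g" "rhom h" "\<And>c. g [:c:] = h [:c:]" "g [:0, 1:] = h [:0, 1:]"
  shows "g p = h p"
proof (induction p)
  case 0
  then show ?case using assms(1,2) by (simp add: rhom.zero)
next
  case (pCons a p)
  have "pCons a p = [:a:] + [:0, 1:] * p" by simp
  then show ?case using assms pCons by (simp only: rhom.add rhom.mult)
qed

subsection \<open>Evaluation of multivariate polynomials\<close>

definition var :: "'i \<Rightarrow> ('i, 'a::zero_neq_one) mpoly"
  where "var i = Poly_Mapping.single (Poly_Mapping.single i 1) 1"

definition mon :: "('i \<Rightarrow> 'c::comm_monoid_mult) \<Rightarrow> ('i \<Rightarrow>\<^sub>0 nat) \<Rightarrow> 'c"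
  where "mon v m = (\<Prod>i\<in>Poly_Mapping.keys m. v i ^ Poly_Mapping.lookup m i)"

text \<open>The universal property of the polynomial ring. The maps \<open>grade\<close>,
  \<open>twist\<close>, \<open>emb\<close>, \<open>restr\<close> and \<open>to_ac_poly\<close> are
  all of this form, so identities between them need checking only on constants and
  variables.\<close>

definition ev :: "('a::zero \<Rightarrow> 'c) \<Rightarrow> ('i \<Rightarrow> 'c) \<Rightarrow> ('i, 'a) mpoly \<Rightarrow> 'c::comm_ring_1"
  where "ev f v p = (\<Sum>m\<in>Poly_Mapping.keys p. f (Poly_Mapping.lookup p m) * mon v m)"

lemma mon_superset:
  assumes "finite S" "Poly_Mapping.keys m \<subseteq> S"
  shows "mon v m = (\<Prod>i\<in>S. v i ^ Poly_Mapping.lookup m i)"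
  unfolding mon_def using assms by (intro prod.mono_neutral_left) (auto simp: in_keys_iff)

lemma mon_0 [simp]: "mon v 0 = 1"
  by (simp add: mon_def)

lemma mon_single [simp]: "mon v (Poly_Mapping.single i n) = v i ^ n"
  by (cases "n = 0") (auto simp: mon_def)

lemma mon_add: "mon v (m + m') = mon v m * mon v m'"
proof -
  let ?S = "Poly_Mapping.keys m \<union> Poly_Mapping.keys m'"
  have "mon v (m + m') = (\<Prod>i\<in>?S. v i ^ Poly_Mapping.lookup (m + m') i)"
    using Poly_Mapping.keys_add[of m m'] by (intro mon_superset) auto
  also have "\<dots> = mon v m * mon v m'"
    by (simp add: lookup_add power_add prod.distrib mon_superset[of ?S])
  finally show ?thesis .
qed

lemma mpoly_sum_monomials:
  "p = (\<Sum>m\<in>Poly_Mapping.keys p. Poly_Mapping.single m (Poly_Mapping.lookup p m))"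
  by (rule poly_mapping_eqI) (auto simp: lookup_sum lookup_single when_def in_keys_iff)

lemma mpoly_induct [case_names single add]:
  assumes "\<And>m c. P (Poly_Mapping.single m c)" "\<And>p q. P p \<Longrightarrow> P q \<Longrightarrow> P (p + q)"
  shows "P (p :: 'i \<Rightarrow>\<^sub>0 'a::comm_monoid_add)"
proof -
  have "P 0" using assms(1)[of undefined 0] by simp
  have "P (\<Sum>m\<in>S. Poly_Mapping.single m (Poly_Mapping.lookup p m))" for S
    by (induction S rule: infinite_finite_induct) (auto intro: assms \<open>P 0\<close>)
  then show ?thesis by (subst mpoly_sum_monomials)
qed

lemma mon_var: "mon var m = Poly_Mapping.single m (1::'a::comm_ring_1)"
proof (induction m rule: mpoly_induct)
  case (single i n)
  show ?case
  proof (induction n)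
    case (Suc n)
    have "mon var (Poly_Mapping.single i (Suc n)) =
        var i * Poly_Mapping.single (Poly_Mapping.single i n) (1::'a)"
      using Suc by simp
    also have "\<dots> = Poly_Mapping.single (Poly_Mapping.single i (Suc n)) 1"
      by (simp add: var_def mult_single flip: single_add)
    finally show ?case .
  qed simp
qed (simp add: mon_add mult_single)

lemma (in rhom) mon_hom: "h (mon v m) = mon (\<lambda>i. h (v i)) m"
  by (simp add: mon_def prod power)

locale ev_hom = rhom f for f :: "'a::comm_ring_1 \<Rightarrow> 'c::comm_ring_1" +
  fixes v :: "'i \<Rightarrow> 'c"
begin

lemma ev_superset:
  assumes "finite S" "Poly_Mapping.keys p \<subseteq> S"
  shows "ev f v p = (\<Sum>m\<in>S. f (Poly_Mapping.lookup p m) * mon v m)"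
  unfolding ev_def using assms by (intro sum.mono_neutral_left) (auto simp: in_keys_iff zero)

lemma ev_single [simp]: "ev f v (Poly_Mapping.single m c) = f c * mon v m"
  by (cases "c = 0") (auto simp: ev_def zero)

lemma ev_add: "ev f v (p + q) = ev f v p + ev f v q"
proof -
  let ?S = "Poly_Mapping.keys p \<union> Poly_Mapping.keys q"
  have "ev f v (p + q) = (\<Sum>m\<in>?S. f (Poly_Mapping.lookup (p + q) m) * mon v m)"
    using Poly_Mapping.keys_add[of p q] by (intro ev_superset) auto
  also have "\<dots> = ev f v p + ev f v q"
    by (simp add: lookup_add add distrib_right sum.distrib ev_superset[of ?S])
  finally show ?thesis .
qed

lemma ev_mult: "ev f v (p * q) = ev f v p * ev f v q"
proof (induction p rule: mpoly_induct)
  case (single m c)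
  show ?case
    by (induction q rule: mpoly_induct)
      (auto simp: mult_single mon_add mult distrib_left ev_add algebra_simps)
qed (simp add: distrib_right ev_add)

lemma ev_var [simp]: "ev f v (var i) = v i"
  by (simp add: var_def one)

lemma ev_const [simp]: "ev f v (const_poly c) = f c"
  by simp

lemma rhom_ev: "rhom (ev f v)"
  by unfold_locales (auto simp: ev_add ev_mult one simp del: single_one simp flip: single_one)

end

lemma rhom_ev: "rhom f \<Longrightarrow> rhom (ev f v)"
  by (rule ev_hom.rhom_ev) (simp add: ev_hom_def)

lemma ev_var: "rhom f \<Longrightarrow> ev f v (var i) = v i"
  by (rule ev_hom.ev_var) (simp add: ev_hom_def)

lemma ev_const: "rhom f \<Longrightarrow> ev f v (const_poly c) = f c"
  by (rule ev_hom.ev_const) (simp add: ev_hom_def)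

text \<open>Uniqueness in the universal property; it reduces the identities between substitutions to
  generators.\<close>

lemma rhom_mpoly_ext:
  fixes g h :: "('i, 'a::comm_ring_1) mpoly \<Rightarrow> 'b::comm_ring_1"
  assumes "rhom g" "rhom h" "\<And>c. g (const_poly c) = h (const_poly c)" "\<And>i. g (var i) = h (var i)"
  shows "g p = h p"
proof (induction p rule: mpoly_induct)
  case (single m c)
  have "Poly_Mapping.single m c = const_poly c * mon var m" by (simp add: mon_var mult_single)
  then show ?case using assms by (simp add: rhom.mult rhom.mon_hom)
next
  case (add p q)
  then show ?case using assms(1,2) by (simp add: rhom.add)
qed

lemma ev_var_id: "ev const_poly var p = p"
  by (rule rhom_mpoly_ext[OF rhom_ev[OF rhom_const_poly] rhom_id])
    (simp_all add: ev_const ev_var rhom_const_poly)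

lemma rhom_to_ac: "rhom to_ac"
  by unfold_locales auto

lemma to_ac_poly_eq_ev: "to_ac_poly p = ev (\<lambda>c. const_poly (to_ac c)) var p"
proof -
  have "ev (\<lambda>c. const_poly (to_ac c)) var p =
      (\<Sum>m\<in>Poly_Mapping.keys p. Poly_Mapping.single m (to_ac (Poly_Mapping.lookup p m)))"
    by (simp add: ev_def mon_var mult_single)
  also have "\<dots> = to_ac_poly p"
    unfolding to_ac_poly_def
    by (rule poly_mapping_eqI)
      (auto simp: lookup_sum lookup_single when_def in_keys_iff map.rep_eq)
  finally show ?thesis ..
qed

lemma lookup_to_ac_poly: "Poly_Mapping.lookup (to_ac_poly p) m = to_ac (Poly_Mapping.lookup p m)"
  by (simp add: to_ac_poly_def map.rep_eq when_def)

lemma keys_to_ac_poly: "Poly_Mapping.keys (to_ac_poly p) = Poly_Mapping.keys p"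
  by (auto simp: in_keys_iff lookup_to_ac_poly)

lemma rhom_to_ac_poly: "rhom to_ac_poly"
  unfolding to_ac_poly_eq_ev by (intro rhom_ev rhom_comp[OF rhom_const_poly rhom_to_ac])

lemma to_ac_poly_eq_0_iff: "to_ac_poly p = 0 \<longleftrightarrow> p = 0"
  by (metis keys_eq_empty keys_to_ac_poly)

lemma to_ac_poly_const: "to_ac_poly (const_poly c) = const_poly (to_ac c)"
  by (simp add: to_ac_poly_def)

lemma to_ac_poly_var: "to_ac_poly (var i) = var i"
  by (simp add: to_ac_poly_def var_def)

subsection \<open>Weighted degrees\<close>

definition wexp :: "('i \<Rightarrow> nat) \<Rightarrow> ('i \<Rightarrow>\<^sub>0 nat) \<Rightarrow> nat"
  where "wexp c m = (\<Sum>i\<in>Poly_Mapping.keys m. c i * Poly_Mapping.lookup m i)"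

text \<open>Substitutes \<open>var i * t ^ c i\<close> for each variable, with a new variable
  \<open>t\<close>. The coefficients in \<open>t\<close> are the weighted homogeneous
  components.\<close>

definition grade :: "('i \<Rightarrow> nat) \<Rightarrow> ('i, 'a::comm_ring_1) mpoly \<Rightarrow> ('i, 'a) mpoly poly"
  where "grade c = ev (\<lambda>a. [:const_poly a:]) (\<lambda>i. monom (var i) (c i))"

text \<open>As a univariate degree it inherits the rules for sums and products. Weights may be 0, so
  it covers the total degree, the degree in one variable and the degree in a set of
  variables.\<close>

definition wt :: "('i \<Rightarrow> nat) \<Rightarrow> ('i, 'a::comm_ring_1) mpoly \<Rightarrow> nat"
  where "wt c p = degree (grade c p)"

lemma rhom_grade: "rhom (grade c)"
  unfolding grade_def by (intro rhom_ev rhom_comp[OF rhom_pCons rhom_const_poly])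

lemma mon_monom: "mon (\<lambda>i. monom (v i) (c i)) m = monom (mon v m) (wexp c m)"
proof -
  have "(\<Prod>i\<in>S. monom (v i) (c i) ^ Poly_Mapping.lookup m i) =
    monom (\<Prod>i\<in>S. v i ^ Poly_Mapping.lookup m i) (\<Sum>i\<in>S. c i * Poly_Mapping.lookup m i)" for S
    by (induction S rule: infinite_finite_induct) (auto simp: monom_power mult_monom)
  then show ?thesis by (simp add: mon_def wexp_def)
qed

lemma grade_eq: "grade c p =
  (\<Sum>m\<in>Poly_Mapping.keys p. monom (Poly_Mapping.single m (Poly_Mapping.lookup p m)) (wexp c m))"
  by (simp add: grade_def ev_def mon_monom mon_var smult_monom mult_single)

lemma lookup_coeff_grade: "Poly_Mapping.lookup (coeff (grade c p) d) m =
  (if wexp c m = d then Poly_Mapping.lookup p m else 0)"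
proof -
  have "Poly_Mapping.lookup (coeff (grade c p) d) m =
    (\<Sum>x\<in>Poly_Mapping.keys p. if x = m then if wexp c m = d then Poly_Mapping.lookup p m else 0 else 0)"
    unfolding grade_eq coeff_sum lookup_sum
    by (rule sum.cong) (auto simp: lookup_single when_def)
  then show ?thesis by (auto simp: in_keys_iff)
qed

lemma grade_eq_0_iff: "grade c p = 0 \<longleftrightarrow> p = 0"
proof
  assume "grade c p = 0"
  then show "p = 0"
    using lookup_coeff_grade[of c p] by (intro poly_mapping_eqI) (metis coeff_0 lookup_zero)
qed (simp add: rhom.zero[OF rhom_grade])

lemma wt_le_iff: "wt c p \<le> n \<longleftrightarrow> (\<forall>m\<in>Poly_Mapping.keys p. wexp c m \<le> n)"
proof
  assume le: "wt c p \<le> n"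
  show "\<forall>m\<in>Poly_Mapping.keys p. wexp c m \<le> n"
  proof
    fix m assume "m \<in> Poly_Mapping.keys p"
    then have "Poly_Mapping.lookup (coeff (grade c p) (wexp c m)) m \<noteq> 0"
      by (simp add: lookup_coeff_grade in_keys_iff)
    then have "coeff (grade c p) (wexp c m) \<noteq> 0" by auto
    with le show "wexp c m \<le> n" using le_degree unfolding wt_def by fastforce
  qed
next
  assume *: "\<forall>m\<in>Poly_Mapping.keys p. wexp c m \<le> n"
  show "wt c p \<le> n" unfolding wt_def
  proof (rule degree_le, intro allI impI poly_mapping_eqI)
    fix i m assume "n < i"
    with * have "m \<notin> Poly_Mapping.keys p" if "wexp c m = i" using that by auto
    then show "Poly_Mapping.lookup (coeff (grade c p) i) m = Poly_Mapping.lookup 0 m"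
      by (auto simp: lookup_coeff_grade in_keys_iff)
  qed
qed

lemma wt_eq_Max: "wt c p = Max (insert 0 (wexp c ` Poly_Mapping.keys p))" (is "_ = ?M")
proof (rule antisym)
  show "wt c p \<le> ?M" by (auto simp: wt_le_iff intro: Max_ge)
  have "\<forall>m\<in>Poly_Mapping.keys p. wexp c m \<le> wt c p" by (simp flip: wt_le_iff)
  then show "?M \<le> wt c p" by auto
qed

lemma wexp_UNIV: "wexp c m = (\<Sum>i\<in>UNIV. c i * Poly_Mapping.lookup m i)"
  for m :: "'n::finite \<Rightarrow>\<^sub>0 nat"
  unfolding wexp_def by (rule sum.mono_neutral_left) (auto simp: in_keys_iff)

lemma wexp_unit: "wexp (\<lambda>j. if j = i then 1 else 0) m = Poly_Mapping.lookup m i"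
proof -
  have "wexp (\<lambda>j. if j = i then 1 else 0) m =
      (\<Sum>j\<in>Poly_Mapping.keys m. if j = i then Poly_Mapping.lookup m i else 0)"
    unfolding wexp_def by (rule sum.cong) auto
  then show ?thesis by (auto simp: in_keys_iff)
qed

lemma degree_in_eq_wt: "degree_in i p = wt (\<lambda>j. if j = i then 1 else 0) p"
  by (simp add: degree_in_def wt_eq_Max wexp_unit)

lemma total_degree_eq_wt: "total_degree p = wt (\<lambda>_. 1) p"
  by (simp add: total_degree_def wt_eq_Max wexp_UNIV)

lemma wt_add: "wt c (p + q) \<le> max (wt c p) (wt c q)"
  unfolding wt_def rhom.add[OF rhom_grade] by (rule degree_add_le_max)

lemma wt_add_eq: "wt c q < wt c p \<Longrightarrow> wt c (p + q) = wt c p"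
  unfolding wt_def rhom.add[OF rhom_grade] by (rule degree_add_eq_left)

lemma wt_uminus: "wt c (- p) = wt c p"
  unfolding wt_def rhom.uminus[OF rhom_grade] by simp

lemma wt_diff_eq: "wt c q < wt c p \<Longrightarrow> wt c (p - q) = wt c p"
  using wt_add_eq[of c "- q" p] by (simp add: wt_uminus)

lemma wt_const [simp]: "wt c (const_poly a) = 0"
  by (simp add: wt_def grade_def ev_const rhom_comp[OF rhom_pCons rhom_const_poly])

lemma wt_1 [simp]: "wt c 1 = 0"
  using wt_const[of c 1] by simp

lemma wt_var [simp]: "wt c (var i :: ('i, 'a::comm_ring_1) mpoly) = c i"
proof -
  have "(var i :: ('i, 'a) mpoly) \<noteq> 0"
    unfolding var_def by (metis lookup_single_eq lookup_zero zero_neq_one)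
  then show ?thesis
    by (simp add: wt_def grade_def ev_var rhom_comp[OF rhom_pCons rhom_const_poly] degree_monom_eq)
qed

subsection \<open>Gauss's lemma\<close>

context graded_domain
begin

text \<open>Descent on the degree: in a proper factorization the nonunit cofactor has positive
  degree.\<close>

lemma irreducible_divisor:
  fixes a :: 'b
  assumes "a \<noteq> 0" "\<not> a dvd 1"
  shows "\<exists>p. Factorial_Ring.irreducible p \<and> p dvd a"
  using assms
proof (induction "\<delta> a" arbitrary: a rule: less_induct)
  case less
  show ?case
  proof (cases "Factorial_Ring.irreducible a")
    case False
    then obtain b c where bc: "a = b * c" "\<not> b dvd 1" "\<not> c dvd 1"
      using less.prems by (auto simp: Factorial_Ring.irreducible_def)
    then have "b \<noteq> 0" "c \<noteq> 0" using less.prems by auto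
    moreover from this bc have "\<delta> c > 0" using deg_0_unit[of c] by blast
    ultimately have "\<delta> b < \<delta> a" by (simp add: bc deg_mult)
    from less.hyps[OF this] bc \<open>b \<noteq> 0\<close> show ?thesis by auto
  qed auto
qed

end

text \<open>\<open>D\<close> plays the role of the polynomials in the first \<open>N\<close>
  variables, a subset rather than a type because \<open>N\<close> varies in an induction. Since
  \<open>D\<close> contains the factors of its nonzero elements, irreducibility and divisibility
  mean the same in \<open>D\<close> as in the whole ring.\<close>

locale gauss = graded_domain \<delta> for \<delta> :: "'b::idom \<Rightarrow> nat" +
  fixes D :: "'b set"
  assumes D_0: "0 \<in> D" and D_1: "1 \<in> D"
    and D_diff: "\<lbrakk>a \<in> D; b \<in> D\<rbrakk> \<Longrightarrow> a - b \<in> D"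
    and D_mult: "\<lbrakk>a \<in> D; b \<in> D\<rbrakk> \<Longrightarrow> a * b \<in> D"
    and D_factor: "\<lbrakk>a * b \<in> D; a * b \<noteq> 0\<rbrakk> \<Longrightarrow> a \<in> D"
    and D_prime: "\<lbrakk>Factorial_Ring.irreducible p; p \<in> D; a \<in> D; b \<in> D; p dvd a * b\<rbrakk>
      \<Longrightarrow> p dvd a \<or> p dvd b"
begin

lemma D_factor': "\<lbrakk>a * b \<in> D; a * b \<noteq> 0\<rbrakk> \<Longrightarrow> b \<in> D"
  using D_factor[of b a] by (simp add: mult.commute)

lemma D_add: "\<lbrakk>a \<in> D; b \<in> D\<rbrakk> \<Longrightarrow> a + b \<in> D"
  using D_diff[of a "0 - b"] D_diff[of 0 b] D_0 by simp

lemma D_sum: "(\<And>i. i \<in> I \<Longrightarrow> f i \<in> D) \<Longrightarrow> sum f I \<in> D"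
  by (induction I rule: infinite_finite_induct) (auto intro: D_0 D_add)

section \<open>Univariate polynomials over the subring \<open>D\<close>\<close>

definition P :: "'b poly set"
  where "P = {f. \<forall>i. coeff f i \<in> D}"

lemma P_coeff: "f \<in> P \<Longrightarrow> coeff f i \<in> D"
  by (simp add: P_def)

lemma P_0: "0 \<in> P"
  by (simp add: P_def D_0)

lemma P_1: "1 \<in> P"
  by (auto simp: P_def coeff_1 D_0 D_1)

lemma P_add: "\<lbrakk>f \<in> P; g \<in> P\<rbrakk> \<Longrightarrow> f + g \<in> P"
  by (simp add: P_def D_add)

lemma P_diff: "\<lbrakk>f \<in> P; g \<in> P\<rbrakk> \<Longrightarrow> f - g \<in> P"
  by (simp add: P_def D_diff)

lemma P_mult: "\<lbrakk>f \<in> P; g \<in> P\<rbrakk> \<Longrightarrow> f * g \<in> P"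
  by (auto simp: P_def coeff_mult intro!: D_sum D_mult)

lemma P_smult: "\<lbrakk>c \<in> D; f \<in> P\<rbrakk> \<Longrightarrow> smult c f \<in> P"
  by (simp add: P_def D_mult)

lemma P_smult_factor: "\<lbrakk>smult c f \<in> P; c \<in> D; c \<noteq> 0\<rbrakk> \<Longrightarrow> f \<in> P"
  unfolding P_def using D_factor' D_0 by (auto, metis mult_eq_0_iff)

lemma P_monom: "c \<in> D \<Longrightarrow> monom c n \<in> P"
  by (auto simp: P_def coeff_monom D_0)

text \<open>The leading coefficient of \<open>s\<close> is a factor of an element of
  \<open>D\<close>, hence in \<open>D\<close>; remove the leading term and continue.\<close>

lemma P_quotient: "\<lbrakk>p * s \<in> P; p \<in> P; p \<noteq> 0\<rbrakk> \<Longrightarrow> s \<in> P"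
proof (induction "degree s" arbitrary: s rule: less_induct)
  case less
  show ?case
  proof (cases "s = 0")
    case False
    have "lead_coeff p * lead_coeff s \<in> D"
      using less.prems(1) P_coeff lead_coeff_mult[of p s] by metis
    then have "lead_coeff s \<in> D" using D_factor' False less.prems(3) by simp
    then have m: "monom (lead_coeff s) (degree s) \<in> P" by (rule P_monom)
    define s' where "s' = s - monom (lead_coeff s) (degree s)"
    have s: "s = s' + monom (lead_coeff s) (degree s)" by (simp add: s'_def)
    have "p * s' \<in> P" using m less.prems by (simp add: s'_def right_diff_distrib P_diff P_mult)
    have "s' \<in> P"
    proof (cases "s' = 0")
      case False
      have "degree s' \<le> degree s" unfolding s'_def
        by (rule degree_diff_le) (auto simp: degree_monom_le)
      moreover have "coeff s' (degree s) = 0" by (simp add: s'_def)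
      ultimately have "degree s' < degree s"
        using False by (metis le_neq_implies_less leading_coeff_0_iff)
      from less.hyps[OF this] show ?thesis using \<open>p * s' \<in> P\<close> less.prems by simp
    qed (simp add: P_0)
    with m s show ?thesis using P_add by metis
  qed (simp add: P_0)
qed

text \<open>Division over the fraction field without fractions: each step multiplies by the leading
  coefficient of \<open>h\<close>.\<close>

lemma pseudo_division:
  assumes "h \<in> P" "h \<noteq> 0" "f \<in> P"
  shows "\<exists>c q r. c \<in> D \<and> c \<noteq> 0 \<and> q \<in> P \<and> r \<in> P \<and> smult c f = q * h + r \<and>
    (r = 0 \<or> degree r < degree h)"
  using assms(3)
proof (induction "degree f" arbitrary: f rule: less_induct)
  case less
  show ?case
  proof (cases "f = 0 \<or> degree f < degree h")
    case True
    then show ?thesis using less.prems by (intro exI[of _ 1] exI[of _ 0] exI[of _ f]) (auto simp: D_1 P_0)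
  next
    case False
    define k where "k = monom (lead_coeff f) (degree f - degree h)"
    define f' where "f' = smult (lead_coeff h) f - k * h"
    have k: "k \<in> P" unfolding k_def by (intro P_monom P_coeff less.prems)
    have lch: "lead_coeff h \<in> D" by (rule P_coeff[OF assms(1)])
    have f': "f' \<in> P" using k lch less.prems assms(1) by (simp add: f'_def P_diff P_mult P_smult)
    have "k \<noteq> 0" using False by (simp add: k_def)
    have "degree k = degree f - degree h" using False by (simp add: k_def degree_monom_eq)
    then have dkh: "degree (k * h) = degree f"
      using False \<open>k \<noteq> 0\<close> assms(2) by (simp add: degree_mult_eq)
    have lkh: "coeff (k * h) (degree f) = lead_coeff f * lead_coeff h"
      using lead_coeff_mult[of k h] by (simp only: dkh \<open>degree k = _\<close>) (simp add: k_def)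
    show ?thesis
    proof (cases "f' = 0")
      case True
      then have "smult (lead_coeff h) f = k * h + 0" by (simp add: f'_def)
      then show ?thesis using lch assms(2) k P_0 leading_coeff_0_iff by blast
    next
      case False
      have "coeff f' (degree f) = 0" using lkh by (simp add: f'_def)
      moreover have "degree f' \<le> degree f" unfolding f'_def
        using dkh by (intro degree_diff_le) (auto simp: degree_smult_le)
      ultimately have "degree f' < degree f"
        using False by (metis le_neq_implies_less leading_coeff_0_iff)
      from less.hyps[OF this f'] obtain c q r where
        *: "c \<in> D" "c \<noteq> 0" "q \<in> P" "r \<in> P" "smult c f' = q * h + r" "r = 0 \<or> degree r < degree h"
        by blast
      have "smult (c * lead_coeff h) f = smult c f' + smult c k * h"
        by (simp add: f'_def smult_diff_right)
      also have "\<dots> = (smult c k + q) * h + r" by (simp add: *(5) algebra_simps)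
      finally have "smult (c * lead_coeff h) f = (smult c k + q) * h + r" .
      moreover have "c * lead_coeff h \<in> D" "c * lead_coeff h \<noteq> 0" "smult c k + q \<in> P"
        using * lch assms(2) k by (auto intro: D_mult P_add P_smult)
      ultimately show ?thesis using * by blast
    qed
  qed
qed

text \<open>Gauss's argument: if \<open>p\<close> divides neither factor, take the first coefficient
  of each that it does not divide. Their product is the only term of the coefficient at
  \<open>i + j\<close> not divisible by \<open>p\<close>.\<close>

lemma const_prime:
  assumes p: "Factorial_Ring.irreducible p" "p \<in> D" and "f \<in> P" "g \<in> P" and "[:p:] dvd f * g"
  shows "[:p:] dvd f \<or> [:p:] dvd g"
proof (rule ccontr)
  assume *: "\<not> ([:p:] dvd f \<or> [:p:] dvd g)"
  then obtain i0 j0 where "\<not> p dvd coeff f i0" "\<not> p dvd coeff g j0"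
    by (auto simp: const_poly_dvd_iff)
  define i where "i = (LEAST i. \<not> p dvd coeff f i)"
  define j where "j = (LEAST j. \<not> p dvd coeff g j)"
  have i: "\<not> p dvd coeff f i" unfolding i_def by (rule LeastI) fact
  have j: "\<not> p dvd coeff g j" unfolding j_def by (rule LeastI) fact
  have i': "p dvd coeff f k" if "k < i" for k using that not_less_Least unfolding i_def by blast
  have j': "p dvd coeff g k" if "k < j" for k using that not_less_Least unfolding j_def by blast
  have "coeff (f * g) (i + j) = coeff f i * coeff g j +
      (\<Sum>a\<in>{..i+j}-{i}. coeff f a * coeff g (i + j - a))"
    unfolding coeff_mult by (subst sum.remove[of _ i]) auto
  moreover have "p dvd (\<Sum>a\<in>{..i+j}-{i}. coeff f a * coeff g (i + j - a))"
  proof (rule dvd_sum)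
    fix a assume "a \<in> {..i+j}-{i}"
    then have "a < i \<or> i + j - a < j" by auto
    then show "p dvd coeff f a * coeff g (i + j - a)" using i' j' by (meson dvd_mult dvd_mult2)
  qed
  moreover have "p dvd coeff (f * g) (i + j)" using assms(5) by (simp add: const_poly_dvd_iff)
  ultimately have "p dvd coeff f i * coeff g j" by (simp add: dvd_add_left_iff)
  then show False using D_prime p assms(3,4) P_coeff i j by blast
qed

text \<open>Irreducible factors of \<open>c\<close> remain prime as constant polynomials, so they
  can be cancelled one by one from \<open>q\<close> or from \<open>h\<close>. Thus a factorization
  of \<open>p\<close> over the fraction field descends to the ring.\<close>

lemma distribute_constant:
  assumes "c \<in> D" "c \<noteq> 0" "q \<in> P" "h \<in> P" "smult c p = q * h"
  shows "\<exists>c1 c2 q' h'. c1 \<in> D \<and> c2 \<in> D \<and> c1 \<noteq> 0 \<and> c2 \<noteq> 0 \<and>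
    q = smult c1 q' \<and> h = smult c2 h' \<and> p = q' * h'"
  using assms
proof (induction "\<delta> c" arbitrary: c q h rule: less_induct)
  case less
  show ?case
  proof (cases "c dvd 1")
    case True
    then obtain u where u: "1 = c * u" by (elim dvdE)
    then have "u \<noteq> 0" by auto
    have "p = smult u (smult c p)" using u by (simp add: mult.commute)
    also have "\<dots> = smult u q * h" by (simp add: less.prems)
    finally have "p = smult u q * h" .
    moreover have "q = smult c (smult u q)" using u by simp
    ultimately show ?thesis using less.prems D_1
      by (intro exI[of _ c] exI[of _ 1] exI[of _ "smult u q"] exI[of _ h]) auto
  next
    case False
    from irreducible_divisor[OF less.prems(2) this] obtain \<pi> d where
      \<pi>: "Factorial_Ring.irreducible \<pi>" "c = \<pi> * d" by (auto elim!: dvdE)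
    have nz: "\<pi> \<noteq> 0" "d \<noteq> 0" using \<pi> less.prems by auto
    have D: "\<pi> \<in> D" "d \<in> D"
      using D_factor[of \<pi> d] D_factor'[of \<pi> d] less.prems \<pi> by auto
    have "\<delta> \<pi> > 0"
      using \<pi> nz deg_0_unit by (metis Factorial_Ring.irreducible_not_unit gr0I)
    then have less_d: "\<delta> d < \<delta> c" using \<pi> nz by (simp add: deg_mult)
    have eq: "smult \<pi> (smult d p) = q * h" using less.prems \<pi> by simp
    then have "q * h = [:\<pi>:] * smult d p" by (simp add: mult.commute)
    then have "[:\<pi>:] dvd q * h" by (rule dvdI)
    then consider "[:\<pi>:] dvd q" | "[:\<pi>:] dvd h" using const_prime \<pi> D less.prems by blast
    then show ?thesis
    proof cases
      case 1
      then obtain q1 where q1: "q = smult \<pi> q1" by (auto elim!: dvdE)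
      then have "q1 \<in> P" using P_smult_factor D nz less.prems by blast
      moreover have "smult \<pi> (smult d p - q1 * h) = 0" using eq q1 by (simp add: smult_diff_right)
      then have "smult d p = q1 * h" using nz by (simp only: smult_eq_0_iff) simp
      ultimately obtain c1 c2 q' h' where
        "c1 \<in> D" "c2 \<in> D" "c1 \<noteq> 0" "c2 \<noteq> 0" "q1 = smult c1 q'" "h = smult c2 h'" "p = q' * h'"
        using less.hyps[OF less_d D(2) nz(2) _ less.prems(4)] by blast
      then show ?thesis using D nz q1 D_mult
        by (intro exI[of _ "\<pi> * c1"] exI[of _ c2] exI[of _ q'] exI[of _ h']) auto
    next
      case 2
      then obtain h1 where h1: "h = smult \<pi> h1" by (auto elim!: dvdE)
      then have "h1 \<in> P" using P_smult_factor D nz less.prems by blast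
      moreover have "smult \<pi> (smult d p - q * h1) = 0" using eq h1 by (simp add: smult_diff_right)
      then have "smult d p = q * h1" using nz by (simp only: smult_eq_0_iff) simp
      ultimately obtain c1 c2 q' h' where
        "c1 \<in> D" "c2 \<in> D" "c1 \<noteq> 0" "c2 \<noteq> 0" "q = smult c1 q'" "h1 = smult c2 h'" "p = q' * h'"
        using less.hyps[OF less_d D(2) nz(2) less.prems(3)] by blast
      then show ?thesis using D nz h1 D_mult
        by (intro exI[of _ c1] exI[of _ "\<pi> * c2"] exI[of _ q'] exI[of _ h']) auto
    qed
  qed
qed

text \<open>An irreducible \<open>p\<close> of positive degree has only unit constant factors. So
  after \<open>c\<close> is distributed over \<open>p\<close> and the cofactor, the part taken out
  of \<open>p\<close> is a unit.\<close>

lemma dvd_smult_cancel: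
  assumes p: "Factorial_Ring.irreducible p" "p \<in> P" "degree p > 0"
    and c: "c \<in> D" "c \<noteq> 0" and f: "f \<in> P" "p dvd smult c f"
  shows "p dvd f"
proof -
  obtain s where s: "smult c f = p * s" using f(2) by (elim dvdE)
  have "p \<noteq> 0" using p by auto
  then have "s \<in> P" using P_quotient[of p s] s p c f by (metis P_smult)
  from distribute_constant[OF c p(2) this s] obtain c1 c2 q h where
    *: "p = smult c1 q" "f = q * h" by blast
  then have "p = [:c1:] * q" by simp
  with p(1) have "[:c1:] dvd 1 \<or> q dvd 1" by (rule Factorial_Ring.irreducibleD)
  moreover have "\<not> q dvd 1"
  proof
    assume "q dvd 1"
    then have "degree q = 0" using degree_1 dvd_imp_degree_le[of q 1] by simp
    then show False using p(3) * by (metis degree_smult_le le_zero_eq less_numeral_extra(3))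
  qed
  ultimately have "[:c1:] dvd 1" by blast
  then have "c1 dvd 1" by (simp add: is_unit_const_poly_iff)
  then obtain u where u: "1 = c1 * u" by (elim dvdE)
  have "p * smult u h = smult (c1 * u) f" using * by (simp add: mult.commute)
  then have "f = p * smult u h" by (simp flip: u)
  then show ?thesis by (rule dvdI)
qed

text \<open>Degree 0 is Gauss's argument. In positive degree this is Euclid's argument over the
  fraction field, with denominators cleared.\<close>

theorem poly_prime:
  assumes p: "Factorial_Ring.irreducible p" "p \<in> P" and f: "f \<in> P" and g: "g \<in> P"
    and dvd: "p dvd f * g"
  shows "p dvd f \<or> p dvd g"
proof (cases "degree p = 0")
  case True
  then obtain c where c: "p = [:c:]" by (metis degree_eq_zeroE)
  have "Factorial_Ring.irreducible c"
  proof (rule Factorial_Ring.irreducibleI)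
    show "c \<noteq> 0" using p c by auto
    show "\<not> c dvd 1" using Factorial_Ring.irreducible_not_unit[OF p(1)] c
      by (simp add: is_unit_const_poly_iff)
    fix a b assume "c = a * b"
    then have "p = [:a:] * [:b:]" by (simp add: c)
    from Factorial_Ring.irreducibleD[OF p(1) this] show "a dvd 1 \<or> b dvd 1"
      by (simp add: is_unit_const_poly_iff)
  qed
  moreover have "c \<in> D" using P_coeff[OF p(2), of 0] c by simp
  ultimately show ?thesis using const_prime[OF _ _ f g] dvd c by blast
next
  case False
  then have dp: "degree p > 0" by simp
  show ?thesis
  proof (rule disjCI)
    assume ng: "\<not> p dvd g"
    \<comment> \<open>The nonzero part of the ideal generated by \<open>p\<close> and
      \<open>f\<close>. An element \<open>h\<close> of least degree divides every member up to a
      nonzero constant of \<open>D\<close>.\<close>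
    define I where "I = {h. h \<noteq> 0 \<and> (\<exists>u\<in>P. \<exists>v\<in>P. h = u * p + v * f)}"
    have "p = 1 * p + 0 * f" "p \<noteq> 0" using False by auto
    then have "p \<in> I" unfolding I_def using P_0 P_1 by blast
    then obtain h where h: "h \<in> I" and min: "\<And>k. k \<in> I \<Longrightarrow> degree h \<le> degree k"
      using ex_has_least_nat[of "\<lambda>h. h \<in> I" p degree] by blast
    then obtain u v where uv: "h = u * p + v * f" "u \<in> P" "v \<in> P" "h \<noteq> 0" by (auto simp: I_def)
    have hP: "h \<in> P" using uv p f by (auto intro: P_add P_mult)
    have reduce: "\<exists>c q. c \<in> D \<and> c \<noteq> 0 \<and> q \<in> P \<and> smult c k = q * h"
      if k: "k = u' * p + v' * f" "u' \<in> P" "v' \<in> P" for k u' v'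
    proof -
      have "k \<in> P" using k p f by (auto intro: P_add P_mult)
      from pseudo_division[OF hP uv(4) this] obtain c q r where
        *: "c \<in> D" "c \<noteq> 0" "q \<in> P" "r \<in> P" "smult c k = q * h + r" "r = 0 \<or> degree r < degree h"
        by blast
      have "r = smult c k - q * h" using *(5) by simp
      also have "\<dots> = (smult c u' - q * u) * p + (smult c v' - q * v) * f"
        by (simp add: k uv(1) algebra_simps smult_add_right)
      finally have r: "r = (smult c u' - q * u) * p + (smult c v' - q * v) * f" .
      moreover have "smult c u' - q * u \<in> P" "smult c v' - q * v \<in> P"
        using * k uv by (auto intro: P_diff P_smult P_mult)
      ultimately have "r = 0 \<or> r \<in> I" unfolding I_def by blast
      with *(6) min[of r] have "r = 0" by auto
      with * show ?thesis by auto
    qed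
    obtain c q where c: "c \<in> D" "c \<noteq> 0" "q \<in> P" "smult c p = q * h"
      using reduce[of p 1 0] P_0 P_1 by auto
    from distribute_constant[OF c(1,2,3) hP c(4)] obtain c1 c2 q' h' where
      *: "c2 \<in> D" "c2 \<noteq> 0" "h = smult c2 h'" "p = q' * h'" by blast
    \<comment> \<open>In the first case \<open>p\<close> divides \<open>h\<close>, hence a constant
      multiple of \<open>f\<close>. In the second \<open>h\<close> is a constant times a unit, and
      its expression by \<open>p\<close> and \<open>f\<close>, times \<open>g\<close>, makes
      \<open>p\<close> divide a constant multiple of \<open>g\<close>.\<close>
    have "q' dvd 1 \<or> h' dvd 1" using p(1) *(4) by (rule Factorial_Ring.irreducibleD)
    then show "p dvd f"
    proof
      assume "q' dvd 1"
      then have "p dvd h'" using *(4) by (metis dvd_mult_unit_iff' dvd_refl dvd_mult_right mult.commute mult_dvd_mono mult_1)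
      then have ph: "p dvd h" using *(3) by (simp add: dvd_smult)
      obtain c' q'' where "c' \<in> D" "c' \<noteq> 0" "smult c' f = q'' * h"
        using reduce[of f 0 1] P_0 P_1 by auto
      then show ?thesis using dvd_smult_cancel[OF p dp _ _ f] ph by auto
    next
      assume "h' dvd 1"
      then obtain k where k: "1 = h' * k" by (elim dvdE)
      have "smult c2 g = smult c2 (h' * k) * g" using k by simp
      also have "\<dots> = h * k * g" by (simp add: *)
      also have "\<dots> = p * (u * k * g) + v * k * (f * g)" by (simp add: uv(1) algebra_simps)
      finally have "p dvd smult c2 g" using dvd by simp
      then have "p dvd g" using dvd_smult_cancel[OF p dp *(1,2) g] by blast
      with ng show ?thesis by blast
    qed
  qed
qed

end

subsection \<open>Polynomials in infinitely many variables\<close>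

lemma wt_mult:
  fixes p q :: "(nat, 'a::idom) mpoly"
  shows "\<lbrakk>p \<noteq> 0; q \<noteq> 0\<rbrakk> \<Longrightarrow> wt c (p * q) = wt c p + wt c q"
  by (simp add: wt_def rhom.mult[OF rhom_grade] degree_mult_eq grade_eq_0_iff)

lemma wt_power:
  fixes p :: "(nat, 'a::idom) mpoly"
  shows "p \<noteq> 0 \<Longrightarrow> wt c (p ^ n) = n * wt c p"
  by (induction n) (auto simp: wt_mult)

lemma wexp_eq_0_iff: "wexp c m = 0 \<longleftrightarrow> (\<forall>i\<in>Poly_Mapping.keys m. c i = 0)"
  by (auto simp: wexp_def in_keys_iff)

lemma wt_eq_0_iff: "wt c p = 0 \<longleftrightarrow> (\<forall>m\<in>Poly_Mapping.keys p. \<forall>i\<in>Poly_Mapping.keys m. c i = 0)"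
  using wt_le_iff[of c p 0] by (simp add: wexp_eq_0_iff)

lemma wt_0_imp_const:
  assumes "wt (\<lambda>_. 1) p = 0"
  shows "p = const_poly (Poly_Mapping.lookup p 0)"
proof (rule poly_mapping_eqI)
  fix m
  have "m = 0" if "m \<in> Poly_Mapping.keys p"
    using assms that by (auto simp: wt_eq_0_iff simp flip: keys_eq_empty)
  then show "Poly_Mapping.lookup p m = Poly_Mapping.lookup (const_poly (Poly_Mapping.lookup p 0)) m"
    by (auto simp: lookup_single when_def in_keys_iff)
qed

lemma const_poly_unit:
  assumes "c \<noteq> (0 :: 'a::field)"
  shows "const_poly c dvd (1 :: ('i, 'a) mpoly)"
proof
  show "(1 :: ('i, 'a) mpoly) = const_poly c * const_poly (inverse c)"
    using assms by (simp add: mult_single)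
qed

interpretation tdeg: graded_domain "wt (\<lambda>_. 1) :: (nat, 'a::field) mpoly \<Rightarrow> nat"
proof
  fix a b :: "(nat, 'a) mpoly"
  show "a dvd 1" if "a \<noteq> 0" "wt (\<lambda>_. 1) a = 0"
    using wt_0_imp_const[OF that(2)] that(1) const_poly_unit by (metis single_zero)
qed (auto simp: wt_mult wt_add)

text \<open>Stated as the vanishing of a weighted degree, so that closure under products and under
  factors follows from additivity of the degree.\<close>

definition vars_below :: "nat \<Rightarrow> (nat, 'a::comm_ring_1) mpoly set"
  where "vars_below N = {p. wt (\<lambda>i. if i < N then 0 else 1) p = 0}"

lemma vars_below_iff:
  "p \<in> vars_below N \<longleftrightarrow> (\<forall>m\<in>Poly_Mapping.keys p. \<forall>i\<in>Poly_Mapping.keys m. i < N)"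
  by (auto simp: vars_below_def wt_eq_0_iff split: if_splits)

lemma vars_below_mono: "N \<le> M \<Longrightarrow> vars_below N \<subseteq> vars_below M"
  by (meson vars_below_iff less_le_trans subsetI)

lemma vars_below_exists: "\<exists>N. p \<in> vars_below N"
proof
  let ?V = "\<Union> (Poly_Mapping.keys ` Poly_Mapping.keys p)"
  have "i < Suc (Max ?V)" if "i \<in> ?V" for i
    using Max_ge[of ?V i] that by (simp add: less_Suc_eq_le)
  then show "p \<in> vars_below (Suc (Max ?V))" unfolding vars_below_iff by blast
qed

lemma vars_below_diff: "\<lbrakk>p \<in> vars_below N; q \<in> vars_below N\<rbrakk> \<Longrightarrow> p - q \<in> vars_below N"
  using wt_add[of _ p "- q"] by (simp add: vars_below_def wt_uminus, metis le_zero_eq max.idem)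

lemma vars_below_mult:
  fixes p q :: "(nat, 'a::idom) mpoly"
  shows "\<lbrakk>p \<in> vars_below N; q \<in> vars_below N\<rbrakk> \<Longrightarrow> p * q \<in> vars_below N"
  by (cases "p = 0 \<or> q = 0") (auto simp: vars_below_def wt_mult)

lemma vars_below_factor:
  fixes p q :: "(nat, 'a::idom) mpoly"
  shows "\<lbrakk>p * q \<in> vars_below N; p * q \<noteq> 0\<rbrakk> \<Longrightarrow> p \<in> vars_below N"
  by (auto simp: vars_below_def wt_mult)

lemma vars_below_const: "const_poly c \<in> vars_below N"
  by (simp add: vars_below_def)

lemma vars_below_var: "i < N \<Longrightarrow> var i \<in> vars_below N"
  by (simp add: vars_below_def)

text \<open>Because there are infinitely many variables, this substitution is an isomorphism onto the
  univariate polynomials over the same ring.\<close>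

definition twist :: "(nat \<Rightarrow> nat) \<Rightarrow> (nat, 'a::comm_ring_1) mpoly \<Rightarrow> (nat, 'a) mpoly poly"
  where "twist e = ev (\<lambda>a. [:const_poly a:]) (case_nat [:0, 1:] (\<lambda>j. [:var j:] + monom 1 (e j)))"

text \<open>Undoes the index shift of \<open>twist\<close>: the coefficient variable
  \<open>i\<close> goes back to \<open>var (Suc i) - var 0 ^ e i\<close>, and the univariate
  variable to \<open>var 0\<close>.\<close>

definition untwist :: "(nat \<Rightarrow> nat) \<Rightarrow> (nat, 'a::comm_ring_1) mpoly poly \<Rightarrow> (nat, 'a) mpoly"
  where "untwist e f = poly (map_poly (ev const_poly (\<lambda>i. var (Suc i) - var 0 ^ e i)) f) (var 0)"

lemma rhom_const_const: "rhom (\<lambda>a. [:const_poly a:])"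
  by (rule rhom_comp[OF rhom_pCons rhom_const_poly])

lemma rhom_twist: "rhom (twist e)"
  unfolding twist_def by (rule rhom_ev[OF rhom_const_const])

lemma rhom_untwist: "rhom (untwist e)"
  unfolding untwist_def by (intro rhom_comp[OF rhom_poly rhom_map_poly] rhom_ev rhom_const_poly)

lemma twist_const: "twist e (const_poly a) = [:const_poly a:]"
  by (simp only: twist_def ev_const[OF rhom_const_const])

lemma twist_var_0: "twist e (var 0) = [:0, 1:]"
  by (simp only: twist_def ev_var[OF rhom_const_const] nat.case)

lemma twist_var_Suc: "twist e (var (Suc i)) = [:var i:] + monom 1 (e i)"
  by (simp only: twist_def ev_var[OF rhom_const_const] nat.case)

lemma untwist_pCons: "untwist e [:c:] = ev const_poly (\<lambda>i. var (Suc i) - var 0 ^ e i) c"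
  by (simp add: untwist_def map_poly_pCons rhom.zero[OF rhom_ev[OF rhom_const_poly]])

lemma untwist_X: "untwist e [:0, 1:] = var 0"
  by (simp add: untwist_def map_poly_pCons rhom.zero[OF rhom_ev[OF rhom_const_poly]]
      rhom.one[OF rhom_ev[OF rhom_const_poly]])

lemma monom_1_eq: "monom 1 n = [:0, 1:] ^ n"
  by (simp add: monom_altdef)

lemma untwist_twist: "untwist e (twist e p) = p"
proof (rule rhom_mpoly_ext[OF rhom_comp[OF rhom_untwist rhom_twist] rhom_id])
  show "untwist e (twist e (var i)) = var i" for i
    by (cases i) (simp_all only: twist_var_0 twist_var_Suc untwist_X untwist_pCons monom_1_eq
        rhom.add[OF rhom_untwist] rhom.power[OF rhom_untwist] ev_var[OF rhom_const_poly]
        diff_add_cancel)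
qed (simp only: twist_const untwist_pCons ev_const[OF rhom_const_poly])

lemma twist_untwist: "twist e (untwist e f) = f"
proof (rule rhom_poly_ext[OF rhom_comp[OF rhom_twist rhom_untwist] rhom_id])
  show "twist e (untwist e [:c:]) = [:c:]" for c
  proof (rule rhom_mpoly_ext[OF rhom_comp[OF rhom_twist rhom_comp[OF rhom_untwist rhom_pCons]] rhom_pCons])
    show "twist e (untwist e [:var i:]) = [:var i:]" for i
      by (simp only: twist_var_0 twist_var_Suc untwist_pCons monom_1_eq add_diff_cancel_right'
          rhom.diff[OF rhom_twist] rhom.power[OF rhom_twist] ev_var[OF rhom_const_poly])
  qed (simp only: twist_const untwist_pCons ev_const[OF rhom_const_poly])
qed (simp only: untwist_X twist_var_0)

lemma twist_dvd_iff: "twist e p dvd twist e q \<longleftrightarrow> p dvd q"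
  using rhom.dvd[OF rhom_twist[of e], of p q]
    rhom.dvd[OF rhom_untwist[of e], of "twist e p" "twist e q"]
  by (auto simp: untwist_twist)

lemma twist_unit_iff: "twist e p dvd 1 \<longleftrightarrow> p dvd 1"
  using twist_dvd_iff[of e p 1] by (simp add: rhom.one[OF rhom_twist])

lemma twist_eq_0_iff: "twist e p = 0 \<longleftrightarrow> p = 0"
  by (metis rhom.zero rhom_twist rhom_untwist untwist_twist)

lemma irreducible_twist:
  assumes "Factorial_Ring.irreducible p"
  shows "Factorial_Ring.irreducible (twist e p)"
proof (rule Factorial_Ring.irreducibleI)
  show "twist e p \<noteq> 0" using assms by (simp add: twist_eq_0_iff Factorial_Ring.irreducible_def)
  show "\<not> twist e p dvd 1" using assms by (simp add: twist_unit_iff Factorial_Ring.irreducible_def)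
  fix a b assume "twist e p = a * b"
  then have "p = untwist e a * untwist e b"
    by (metis rhom.mult rhom_untwist untwist_twist)
  from Factorial_Ring.irreducibleD[OF assms this] show "a dvd 1 \<or> b dvd 1"
    by (metis twist_unit_iff twist_untwist)
qed

subsection \<open>Unique factorization\<close>

text \<open>Induction on the number of variables: \<open>twist\<close> turns variable 0 into the
  variable of a univariate polynomial over the first \<open>N\<close> variables, where
  \<open>poly_prime\<close> applies.\<close>

lemma prime_vars_below:
  fixes p f g :: "(nat, 'a::field) mpoly"
  assumes "Factorial_Ring.irreducible p" "p dvd f * g"
    and "p \<in> vars_below N" "f \<in> vars_below N" "g \<in> vars_below N"
  shows "p dvd f \<or> p dvd g"
  using assms
proof (induction N arbitrary: p f g)
  case 0
  \<comment> \<open>Without variables \<open>p\<close> would be a nonzero constant, so the case is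
    void.\<close>
  then have "p dvd 1"
    by (intro tdeg.deg_0_unit) (auto simp: vars_below_def Factorial_Ring.irreducible_def)
  with 0 show ?case by (simp add: Factorial_Ring.irreducible_def)
next
  case (Suc N)
  interpret gauss "wt (\<lambda>_. 1) :: (nat, 'a) mpoly \<Rightarrow> nat" "vars_below N"
  proof
    show "0 \<in> vars_below N" "1 \<in> vars_below N"
      using vars_below_const[of 0 N] vars_below_const[of 1 N] by simp_all
    show "p dvd a \<or> p dvd b" if "Factorial_Ring.irreducible p" "p \<in> vars_below N"
      "a \<in> vars_below N" "b \<in> vars_below N" "p dvd a * b" for p a b :: "(nat, 'a) mpoly"
      using Suc.IH that by blast
  qed (auto intro: vars_below_diff vars_below_mult vars_below_factor)
  \<comment> \<open>Any exponents serve: it matters only that \<open>twist\<close> preserves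
    divisibility both ways and maps into \<open>P\<close>.\<close>
  define e where "e = (\<lambda>_::nat. 1::nat)"
  have P_prod: "prod h I \<in> P" if "\<And>i. i \<in> I \<Longrightarrow> h i \<in> P" for h :: "nat \<Rightarrow> (nat, 'a) mpoly poly" and I
    using that by (induction I rule: infinite_finite_induct) (auto intro: P_1 P_mult)
  have P_power: "h ^ n \<in> P" if "h \<in> P" for h n
    using that by (induction n) (auto intro: P_1 P_mult)
  have P_sum: "sum h I \<in> P" if "\<And>i. i \<in> I \<Longrightarrow> h i \<in> P"
    for h :: "(nat \<Rightarrow>\<^sub>0 nat) \<Rightarrow> (nat, 'a) mpoly poly" and I
    using that by (induction I rule: infinite_finite_induct) (auto intro: P_0 P_add)
  have P_const: "[:c:] \<in> P" if "c \<in> vars_below N" for c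
    using P_monom[OF that, of 0] by (simp add: monom_0)
  have P_var: "case_nat [:0, 1:] (\<lambda>j. [:var j:] + monom 1 (e j)) i \<in> P" if "i < Suc N" for i
  proof (cases i)
    case 0
    then show ?thesis using P_monom[OF D_1, of 1] by (simp add: monom_1_eq)
  next
    case (Suc j)
    then have "var j \<in> vars_below N" using that by (intro vars_below_var) simp
    then show ?thesis unfolding Suc nat.case by (intro P_add P_const P_monom D_1)
  qed
  have P_twist: "twist e q \<in> P" if "q \<in> vars_below (Suc N)" for q
    unfolding twist_def ev_def mon_def using that P_var
    by (intro P_sum P_mult P_prod P_power P_const vars_below_const) (auto simp: vars_below_iff)
  have "twist e p dvd twist e f * twist e g"
    using Suc.prems(2) by (simp add: twist_dvd_iff flip: rhom.mult[OF rhom_twist])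
  then have "twist e p dvd twist e f \<or> twist e p dvd twist e g"
    using poly_prime[OF irreducible_twist] P_twist Suc.prems by blast
  then show ?case by (simp add: twist_dvd_iff)
qed

text \<open>Only finitely many variables occur in three polynomials.\<close>

theorem irreducible_imp_prime_mpoly:
  fixes p f g :: "(nat, 'a::field) mpoly"
  assumes "Factorial_Ring.irreducible p" "p dvd f * g"
  shows "p dvd f \<or> p dvd g"
proof -
  obtain i j k where "p \<in> vars_below i" "f \<in> vars_below j" "g \<in> vars_below k"
    using vars_below_exists by metis
  then have "p \<in> vars_below (i + j + k)" "f \<in> vars_below (i + j + k)" "g \<in> vars_below (i + j + k)"
    using vars_below_mono[of i "i + j + k"] vars_below_mono[of j "i + j + k"]
      vars_below_mono[of k "i + j + k"] by auto
  then show ?thesis using prime_vars_below assms by blast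
qed

lemma irreducible_dvd_prod:
  fixes p :: "(nat, 'a::field) mpoly"
  assumes "Factorial_Ring.irreducible p" "p dvd prod f I"
  shows "\<exists>i\<in>I. p dvd f i"
  using assms(2)
proof (induction I rule: infinite_finite_induct)
  case (insert i I)
  then show ?case using irreducible_imp_prime_mpoly[OF assms(1), of "f i" "prod f I"] by auto
qed (use assms(1) in \<open>auto simp: Factorial_Ring.irreducible_def\<close>)

lemma rel_prime_iff_no_irreducible:
  fixes p q :: "(nat, 'a::field) mpoly"
  assumes "p \<noteq> 0"
  shows "rel_prime p q \<longleftrightarrow> \<not> (\<exists>\<pi>. Factorial_Ring.irreducible \<pi> \<and> \<pi> dvd p \<and> \<pi> dvd q)"
proof
  assume "rel_prime p q"
  then show "\<not> (\<exists>\<pi>. Factorial_Ring.irreducible \<pi> \<and> \<pi> dvd p \<and> \<pi> dvd q)"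
    by (auto simp: rel_prime_def Factorial_Ring.irreducible_def)
next
  assume *: "\<not> (\<exists>\<pi>. Factorial_Ring.irreducible \<pi> \<and> \<pi> dvd p \<and> \<pi> dvd q)"
  show "rel_prime p q" unfolding rel_prime_def
  proof (intro allI impI, rule ccontr)
    fix c assume c: "c dvd p" "c dvd q" "\<not> c dvd 1"
    then have "c \<noteq> 0" using assms by auto
    from tdeg.irreducible_divisor[OF this c(3)] c * show False by (meson dvd_trans)
  qed
qed

text \<open>Irreducible factors of \<open>q\<close> are prime and do not divide \<open>p\<close>, so
  they cancel against \<open>s\<close> one at a time while the degree of \<open>q\<close>
  drops.\<close>

lemma rel_prime_dvd_mult:
  fixes p q s :: "(nat, 'a::field) mpoly"
  assumes "rel_prime p q" "q \<noteq> 0" "q dvd s * p"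
  shows "q dvd s"
  using assms
proof (induction "wt (\<lambda>_. 1) q" arbitrary: q s rule: less_induct)
  case less
  show ?case
  proof (cases "q dvd 1")
    case True
    then show ?thesis by (rule dvd_trans) simp
  next
    case False
    from tdeg.irreducible_divisor[OF less.prems(2) this] obtain \<pi> r where
      \<pi>: "Factorial_Ring.irreducible \<pi>" and q: "q = \<pi> * r" by (auto elim!: dvdE)
    have nz: "\<pi> \<noteq> 0" "r \<noteq> 0" using less.prems q by auto
    have "\<not> \<pi> dvd p"
      using less.prems(1) \<pi> q by (auto simp: rel_prime_def Factorial_Ring.irreducible_def)
    moreover have "\<pi> dvd s * p" using less.prems(3) q by (metis dvd_mult_left)
    ultimately have "\<pi> dvd s" using irreducible_imp_prime_mpoly[OF \<pi>] by blast
    then obtain s' where s': "s = \<pi> * s'" by (elim dvdE)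
    have "\<pi> * r dvd \<pi> * (s' * p)" using less.prems(3) by (simp add: q s' mult.assoc)
    then have "r dvd s' * p" using nz by simp
    moreover have "rel_prime p r" using less.prems(1) by (auto simp: rel_prime_def q)
    moreover have "wt (\<lambda>_. 1) \<pi> > 0"
      using \<pi> nz tdeg.deg_0_unit[of \<pi>] by (auto simp: Factorial_Ring.irreducible_def)
    then have "wt (\<lambda>_. 1) r < wt (\<lambda>_. 1) q" using nz by (simp add: q wt_mult)
    ultimately have "r dvd s'" using less.hyps nz by blast
    then show ?thesis by (simp add: q s')
  qed
qed

subsection \<open>Coprimality over the algebraic closure\<close>

text \<open>Over the ground field, the independent set consisting of \<open>c\<close> alone extends
  to a basis of the algebraic closure.\<close>

lemma alg_closure_functional:
  fixes c :: "'k::field alg_closure"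
  assumes "c \<noteq> 0"
  shows "\<exists>\<phi> :: 'k alg_closure \<Rightarrow> 'k. (\<forall>x y. \<phi> (x + y) = \<phi> x + \<phi> y) \<and>
    (\<forall>a x. \<phi> (to_ac a * x) = a * \<phi> x) \<and> \<phi> c \<noteq> 0"
proof -
  interpret vector_space_pair "\<lambda>(a::'k) x. to_ac a * x" "(*) :: 'k \<Rightarrow> 'k \<Rightarrow> 'k"
    by unfold_locales (auto simp: algebra_simps)
  have "vs1.independent {c}" using assms by simp
  from linear_independent_extend[OF this, of "\<lambda>_. 1"] obtain \<phi> where
    \<phi>: "Vector_Spaces.linear (\<lambda>a x. to_ac a * x) (*) \<phi>" "\<phi> c = 1" by auto
  interpret \<phi>: Vector_Spaces.linear "\<lambda>(a::'k) x. to_ac a * x" "(*)" \<phi> by fact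
  show ?thesis using \<phi>.add \<phi>.scale \<phi>(2) by (intro exI[of _ \<phi>]) auto
qed

text \<open>Applied to coefficients, a functional linear over the ground field becomes linear over
  its polynomial ring, so it transports polynomial relations.\<close>

lemma map_mult_to_ac_poly:
  fixes \<phi> :: "'k::field alg_closure \<Rightarrow> 'k" and z :: "('i, 'k alg_closure) mpoly"
  assumes add: "\<And>x y. \<phi> (x + y) = \<phi> x + \<phi> y" and scale: "\<And>a x. \<phi> (to_ac a * x) = a * \<phi> x"
  shows "Poly_Mapping.map \<phi> (z * to_ac_poly p) = Poly_Mapping.map \<phi> z * p"
proof -
  have \<phi>0: "\<phi> 0 = 0" using add[of 0 0] by (metis add.right_neutral add_left_cancel)
  have lookup_map: "Poly_Mapping.lookup (Poly_Mapping.map \<phi> f) m = \<phi> (Poly_Mapping.lookup f m)"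
    for f :: "('i, 'k alg_closure) mpoly" and m
    by (simp add: map.rep_eq when_def \<phi>0)
  have map_add: "Poly_Mapping.map \<phi> (f + g) = Poly_Mapping.map \<phi> f + Poly_Mapping.map \<phi> g"
    for f g :: "('i, 'k alg_closure) mpoly"
    by (rule poly_mapping_eqI) (simp add: lookup_map lookup_add add)
  show ?thesis
  proof (induction p rule: mpoly_induct)
    case (single m a)
    show ?case
    proof (induction z rule: mpoly_induct)
      case (single m' x)
      show ?case using scale[of a x]
        by (simp add: to_ac_poly_def mult_single \<phi>0 mult.commute add.commute)
    qed (simp add: distrib_right map_add)
  qed (simp add: distrib_left map_add rhom.add[OF rhom_to_ac_poly])
qed

text \<open>A common factor over the algebraic closure gives a relation \<open>s * p = t * q\<close> with \<open>s\<close> of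
  smaller degree than \<open>q\<close>; a linear functional moves it to the ground field.\<close>

theorem rel_prime_alg_closure:
  fixes p q :: "(nat, 'k::field) mpoly"
  assumes pq: "rel_prime p q" "q \<noteq> 0" and g: "g dvd to_ac_poly p" "g dvd to_ac_poly q"
  shows "g dvd 1"
proof (rule ccontr)
  assume nunit: "\<not> g dvd 1"
  obtain p' q' where p': "to_ac_poly p = g * p'" and q': "to_ac_poly q = g * q'"
    using g by (auto elim!: dvdE)
  have nz: "g \<noteq> 0" "q' \<noteq> 0" using q' pq(2) to_ac_poly_eq_0_iff[of q] by auto
  then obtain m where m: "Poly_Mapping.lookup q' m \<noteq> 0" by (metis lookup_zero poly_mapping_eqI)
  from alg_closure_functional[OF m] obtain \<phi> :: "'k alg_closure \<Rightarrow> 'k" where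
    \<phi>: "\<And>x y. \<phi> (x + y) = \<phi> x + \<phi> y" "\<And>a x. \<phi> (to_ac a * x) = a * \<phi> x"
      "\<phi> (Poly_Mapping.lookup q' m) \<noteq> 0" by blast
  define s where "s = Poly_Mapping.map \<phi> q'"
  have "q' * to_ac_poly p = p' * to_ac_poly q" by (simp add: p' q' mult_ac)
  then have "s * p = Poly_Mapping.map \<phi> p' * q"
    using map_mult_to_ac_poly[OF \<phi>(1,2)] by (metis s_def)
  then have "q dvd s" using rel_prime_dvd_mult[OF pq] by simp
  have "Poly_Mapping.lookup s m \<noteq> 0" using \<phi>(3) m by (simp add: s_def map.rep_eq)
  then have "s \<noteq> 0" by auto
  \<comment> \<open>The contradiction is one of degrees: \<open>q\<close> divides the nonzero
    \<open>s\<close>, but the monomials of \<open>s\<close> occur in \<open>q'\<close>, whose degree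
    is smaller by that of the nonunit \<open>g\<close>.\<close>
  then have "wt (\<lambda>_. 1) q \<le> wt (\<lambda>_. 1) s" using tdeg.deg_dvd \<open>q dvd s\<close> by blast
  also have "\<dots> \<le> wt (\<lambda>_. 1) q'"
  proof -
    have "Poly_Mapping.keys s \<subseteq> Poly_Mapping.keys q'"
      by (auto simp: s_def in_keys_iff map.rep_eq when_def)
    then show ?thesis using wt_le_iff[of "\<lambda>_. 1" q' "wt (\<lambda>_. 1) q'"]
      by (auto simp: wt_le_iff)
  qed
  also have "wt (\<lambda>_. 1) g > 0" using tdeg.deg_0_unit[of g] nunit nz by auto
  then have "wt (\<lambda>_. 1) q' < wt (\<lambda>_. 1) (to_ac_poly q)" using nz by (simp add: q' wt_mult)
  also have "wt (\<lambda>_. 1) (to_ac_poly q) = wt (\<lambda>_. 1) q" by (simp add: wt_eq_Max keys_to_ac_poly)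
  finally show False by simp
qed

subsection \<open>Noether normalization\<close>

text \<open>Uniqueness of base-\<open>b\<close> digits: reduce modulo \<open>b\<close> to compare
  the lowest digit, then divide by \<open>b\<close>.\<close>

lemma digits_unique:
  fixes f g :: "nat \<Rightarrow> nat"
  assumes "\<And>i. f i < b" "\<And>i. g i < b" "(\<Sum>i<N. b ^ i * f i) = (\<Sum>i<N. b ^ i * g i)" "i < N"
  shows "f i = g i"
  using assms
proof (induction N arbitrary: f g i)
  case (Suc N)
  have split: "(\<Sum>i<Suc N. b ^ i * h i) = h 0 + b * (\<Sum>i<N. b ^ i * h (Suc i))" for h :: "nat \<Rightarrow> nat"
    by (simp add: sum.lessThan_Suc_shift sum_distrib_left mult.assoc del: sum.lessThan_Suc)
  note eq = Suc.prems(3)[unfolded split]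
  from arg_cong[OF eq, of "\<lambda>n. n mod b"] have 0: "f 0 = g 0"
    using Suc.prems(1,2) by simp
  have "b > 0" using Suc.prems(1)[of 0] by simp
  with eq 0 have eq': "(\<Sum>i<N. b ^ i * f (Suc i)) = (\<Sum>i<N. b ^ i * g (Suc i))" by simp
  have "f (Suc j) = g (Suc j)" if "j < N" for j
    by (rule Suc.IH[OF Suc.prems(1,2) eq' that])
  with 0 Suc.prems(4) show ?case by (cases i) auto
qed simp

text \<open>Kronecker's device: exponents below \<open>b\<close> are the base-\<open>b\<close>
  digits of the weighted exponent.\<close>

lemma wexp_power_inj:
  assumes "\<And>i. Poly_Mapping.lookup m i < b" "\<And>i. Poly_Mapping.lookup m' i < b"
    and "wexp (\<lambda>i. b ^ i) m = wexp (\<lambda>i. b ^ i) m'"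
  shows "m = m'"
proof -
  define N where "N = Suc (Max (insert 0 (Poly_Mapping.keys m \<union> Poly_Mapping.keys m')))"
  have sub: "Poly_Mapping.keys m \<subseteq> {..<N}" "Poly_Mapping.keys m' \<subseteq> {..<N}"
    by (auto simp: N_def less_Suc_eq_le intro!: Max_ge)
  have w: "wexp (\<lambda>i. b ^ i) x = (\<Sum>i<N. b ^ i * Poly_Mapping.lookup x i)"
    if "Poly_Mapping.keys x \<subseteq> {..<N}" for x
    unfolding wexp_def using that by (intro sum.mono_neutral_left) (auto simp: in_keys_iff)
  have "Poly_Mapping.lookup m i = Poly_Mapping.lookup m' i" for i
  proof (cases "i < N")
    case True
    from assms(3) have "(\<Sum>i<N. b ^ i * Poly_Mapping.lookup m i) = (\<Sum>i<N. b ^ i * Poly_Mapping.lookup m' i)"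
      unfolding w[OF sub(1)] w[OF sub(2)] .
    from digits_unique[OF assms(1,2) this True] show ?thesis .
  next
    case False
    then have "i \<notin> Poly_Mapping.keys m" "i \<notin> Poly_Mapping.keys m'" using sub by auto
    then show ?thesis by (simp add: in_keys_iff)
  qed
  then show ?thesis by (rule poly_mapping_eqI)
qed

text \<open>The image of variable \<open>i\<close> is monic of degree \<open>b ^ i\<close>,
  including \<open>b ^ 0\<close> for variable 0. Distinct monomials of \<open>p\<close> then have
  images of distinct degrees, so the top one survives with a constant coefficient.\<close>

lemma twist_lead_coeff:
  fixes p :: "(nat, 'a::field) mpoly"
  assumes "p \<noteq> 0" "b > 0" and bound: "\<And>m i. m \<in> Poly_Mapping.keys p \<Longrightarrow> Poly_Mapping.lookup m i < b"
  shows "lead_coeff (twist (\<lambda>i. b ^ Suc i) p) dvd 1"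
proof -
  define v :: "nat \<Rightarrow> (nat, 'a) mpoly poly"
    where "v = case_nat [:0, 1:] (\<lambda>j. [:var j:] + monom 1 (b ^ Suc j))"
  have v: "degree (v i) = b ^ i \<and> lead_coeff (v i) = 1" for i
  proof (cases i)
    case (Suc j)
    have "degree [:var j :: (nat, 'a) mpoly:] < degree (monom (1 :: (nat, 'a) mpoly) (b ^ Suc j))"
      using assms(2) by (simp add: degree_monom_eq)
    from degree_add_eq_right[OF this] lead_coeff_add_le[OF this] show ?thesis
      unfolding v_def Suc nat.case by (simp add: degree_monom_eq)
  qed (simp add: v_def)
  have v0: "v i \<noteq> 0" for i using v[of i] by auto
  have deg_mon: "degree (mon v m) = wexp (\<lambda>i. b ^ i) m" for m
    unfolding mon_def wexp_def using v v0
    by (subst degree_prod_sum_eq) (auto simp: degree_power_eq mult.commute)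
  have lead_mon: "lead_coeff (mon v m) = 1" for m
    unfolding mon_def lead_coeff_prod lead_coeff_power by (simp only: conjunct2[OF v] power_one prod.neutral_const)
  have mon0: "mon v m \<noteq> 0" for m using lead_mon[of m] by auto
  let ?K = "Poly_Mapping.keys p"
  define w where "w = wexp (\<lambda>i. b ^ i)"
  have K: "finite ?K" "?K \<noteq> {}" using assms(1) by auto
  have "Max (w ` ?K) \<in> w ` ?K" using K by (intro Max_in) auto
  then obtain M where M: "M \<in> ?K" "w M = Max (w ` ?K)" by auto
  have less: "w m < w M" if "m \<in> ?K - {M}" for m
  proof -
    have "w m \<le> w M" unfolding M(2) using that K by (intro Max_ge) auto
    moreover have "w m \<noteq> w M"
      using wexp_power_inj[of m b M] bound M(1) that unfolding w_def by auto
    ultimately show ?thesis by simp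
  qed
  have "twist (\<lambda>i. b ^ Suc i) p = (\<Sum>m\<in>?K. [:const_poly (Poly_Mapping.lookup p m):] * mon v m)"
    by (simp only: twist_def ev_def v_def)
  then have tw: "twist (\<lambda>i. b ^ Suc i) p = (\<Sum>m\<in>?K. smult (const_poly (Poly_Mapping.lookup p m)) (mon v m))"
    by simp
  have deg_le: "degree (twist (\<lambda>i. b ^ Suc i) p) \<le> w M"
    unfolding tw
  proof (rule degree_sum_le)
    fix m assume m: "m \<in> ?K"
    have "degree (smult (const_poly (Poly_Mapping.lookup p m)) (mon v m)) \<le> degree (mon v m)"
      by (rule degree_smult_le)
    also have "\<dots> = w m" by (simp only: deg_mon w_def)
    also have "w m \<le> w M" using less[of m] m by (cases "m = M") auto
    finally show "degree (smult (const_poly (Poly_Mapping.lookup p m)) (mon v m)) \<le> w M" .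
  qed (rule K(1))
  have "coeff (twist (\<lambda>i. b ^ Suc i) p) (w M) =
      (\<Sum>m\<in>?K. const_poly (Poly_Mapping.lookup p m) * coeff (mon v m) (w M))"
    by (simp only: tw coeff_sum coeff_smult)
  also have "\<dots> = (\<Sum>m\<in>?K. if m = M then const_poly (Poly_Mapping.lookup p M) else 0)"
  proof (rule sum.cong)
    fix m assume m: "m \<in> ?K"
    show "const_poly (Poly_Mapping.lookup p m) * coeff (mon v m) (w M) =
      (if m = M then const_poly (Poly_Mapping.lookup p M) else 0)"
    proof (cases "m = M")
      case True
      then show ?thesis using lead_mon[of M] unfolding deg_mon w_def by simp
    next
      case False
      then have "degree (mon v m) < w M" using less[of m] m unfolding deg_mon w_def by simp
      then have "coeff (mon v m) (w M) = 0" by (rule coeff_eq_0)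
      with False show ?thesis by simp
    qed
  qed simp
  also have "\<dots> = const_poly (Poly_Mapping.lookup p M)" using M(1) by simp
  finally have coeff: "coeff (twist (\<lambda>i. b ^ Suc i) p) (w M) = const_poly (Poly_Mapping.lookup p M)" .
  have unit: "const_poly (Poly_Mapping.lookup p M) dvd (1 :: (nat, 'a) mpoly)"
    using M(1) by (intro const_poly_unit) (simp add: in_keys_iff)
  then have "coeff (twist (\<lambda>i. b ^ Suc i) p) (w M) \<noteq> 0" unfolding coeff by auto
  then have "degree (twist (\<lambda>i. b ^ Suc i) p) = w M" using deg_le le_degree by (metis le_antisym)
  then show ?thesis using coeff unit by metis
qed

lemma noether_normalization:
  fixes F :: "(nat, 'a::field) mpoly set"
  assumes "finite F" "0 \<notin> F"
  shows "\<exists>e. (\<forall>i. e i > 0) \<and> (\<forall>p\<in>F. lead_coeff (twist e p) dvd 1)"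
proof -
  \<comment> \<open>All exponents in \<open>F\<close>. The range of an exponent vector holds only
    its nonzero values, hence the inserted 0.\<close>
  define S where "S = insert 0 (\<Union>p\<in>F. \<Union>m\<in>Poly_Mapping.keys p. Poly_Mapping.range m)"
  define b where "b = Suc (Max S)"
  have S: "finite S" unfolding S_def using assms(1) by simp
  have bound: "Poly_Mapping.lookup m i < b" if "p \<in> F" "m \<in> Poly_Mapping.keys p" for p m i
  proof -
    have "Poly_Mapping.lookup m i \<in> insert 0 (Poly_Mapping.range m)"
      by (cases "Poly_Mapping.lookup m i = 0") (simp_all add: in_keys_iff)
    then have "Poly_Mapping.lookup m i \<in> S" using that unfolding S_def by blast
    then show ?thesis using S by (simp add: b_def less_Suc_eq_le)
  qed
  have b: "b > 0" by (simp add: b_def)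
  show ?thesis
  proof (intro exI[of _ "\<lambda>i. b ^ Suc i"] conjI allI ballI)
    show "b ^ Suc i > 0" for i using b by simp
    show "lead_coeff (twist (\<lambda>i. b ^ Suc i) p) dvd 1" if "p \<in> F" for p
      using assms(2) that b bound by (intro twist_lead_coeff) metis+
  qed
qed

subsection \<open>Embedding finitely many variables into infinitely many\<close>

text \<open>The library makes \<open>('n, 'a) mpoly\<close> an integral domain only for linearly ordered \<open>'n\<close>, so
  divisibility arguments take place in \<open>(nat, 'a) mpoly\<close>.\<close>

definition emb :: "('n \<Rightarrow> nat) \<Rightarrow> ('n, 'a::comm_ring_1) mpoly \<Rightarrow> (nat, 'a) mpoly"
  where "emb ix = ev const_poly (\<lambda>i. var (ix i))"

lemma rhom_emb: "rhom (emb ix)"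
  unfolding emb_def by (rule rhom_ev[OF rhom_const_poly])

lemma emb_const: "emb ix (const_poly c) = const_poly c"
  by (simp only: emb_def ev_const[OF rhom_const_poly])

lemma emb_var: "emb ix (var i) = var (ix i)"
  by (simp only: emb_def ev_var[OF rhom_const_poly])

lemma emb_to_ac_poly: "emb ix (to_ac_poly p) = to_ac_poly (emb ix p)"
proof (rule rhom_mpoly_ext[OF rhom_comp[OF rhom_emb rhom_to_ac_poly]
      rhom_comp[OF rhom_to_ac_poly rhom_emb]])
qed (simp_all only: emb_const emb_var to_ac_poly_const to_ac_poly_var)

definition restr :: "nat \<Rightarrow> (nat \<Rightarrow> 'n) \<Rightarrow> (nat, 'a::comm_ring_1) mpoly \<Rightarrow> ('n, 'a) mpoly"
  where "restr N rx = ev const_poly (\<lambda>j. if j < N then var (rx j) else 0)"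

lemma rhom_restr: "rhom (restr N rx)"
  unfolding restr_def by (rule rhom_ev[OF rhom_const_poly])

lemma restr_const: "restr N rx (const_poly c) = const_poly c"
  by (simp only: restr_def ev_const[OF rhom_const_poly])

lemma restr_var: "restr N rx (var j) = (if j < N then var (rx j) else 0)"
  by (simp only: restr_def ev_var[OF rhom_const_poly])

locale numbering =
  fixes ix :: "'n \<Rightarrow> nat" and rx :: "nat \<Rightarrow> 'n" and N :: nat
  assumes ix_less: "ix i < N" and rx_ix: "rx (ix i) = i" and ix_rx: "j < N \<Longrightarrow> ix (rx j) = j"
begin

lemma restr_emb: "restr N rx (emb ix p) = p"
proof (rule rhom_mpoly_ext[OF rhom_comp[OF rhom_restr rhom_emb] rhom_id])
qed (simp_all add: emb_const emb_var restr_const restr_var ix_less rx_ix)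

lemma emb_inj: "emb ix p = emb ix q \<Longrightarrow> p = q"
  by (metis restr_emb)

lemma emb_eq_0_iff: "emb ix p = 0 \<longleftrightarrow> p = 0"
  using emb_inj[of p 0] by (auto simp: rhom.zero[OF rhom_emb])

text \<open>On polynomials in the first \<open>N\<close> variables the composite substitution fixes
  every variable that occurs; the value 0 for later variables is a dummy.\<close>

lemma emb_restr:
  assumes "p \<in> vars_below N"
  shows "emb ix (restr N rx p) = p"
proof -
  have "emb ix (restr N rx p) = ev const_poly (\<lambda>j. if j < N then var j else 0) p"
    by (rule rhom_mpoly_ext[OF rhom_comp[OF rhom_emb rhom_restr] rhom_ev[OF rhom_const_poly]])
      (simp_all add: ev_var ev_const rhom_const_poly restr_const restr_var emb_const emb_var ix_rx
        rhom.zero[OF rhom_emb])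
  also have "\<dots> = ev const_poly var p"
    unfolding ev_def mon_def using assms by (auto simp: vars_below_iff intro!: sum.cong prod.cong)
  finally show ?thesis by (simp add: ev_var_id)
qed

text \<open>\<open>emb ix\<close> commutes with \<open>grade\<close> and, being injective, does not
  lower the degree when applied to coefficients.\<close>

lemma wt_emb: "wt c (emb ix p) = wt (\<lambda>i. c (ix i)) p"
proof -
  have m: "map_poly (emb ix) (monom q n) = monom (emb ix q) n" for q n
    by (rule map_poly_monom) (simp add: rhom.zero[OF rhom_emb])
  have "grade c (emb ix p) = map_poly (emb ix) (grade (\<lambda>i. c (ix i)) p)"
  proof (rule rhom_mpoly_ext[OF rhom_comp[OF rhom_grade rhom_emb]
        rhom_comp[OF rhom_map_poly[OF rhom_emb] rhom_grade]])
    show "grade c (emb ix (const_poly a)) = map_poly (emb ix) (grade (\<lambda>i. c (ix i)) (const_poly a))"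
      for a using m[of "const_poly a" 0]
      by (simp only: emb_const grade_def ev_const[OF rhom_const_const] monom_0)
    show "grade c (emb ix (var i)) = map_poly (emb ix) (grade (\<lambda>i. c (ix i)) (var i))" for i
      by (simp only: emb_var grade_def ev_var[OF rhom_const_const] m)
  qed
  then show ?thesis
    unfolding wt_def by (simp add: degree_map_poly emb_eq_0_iff)
qed

lemma emb_vars_below: "emb ix p \<in> vars_below N"
  unfolding vars_below_def mem_Collect_eq wt_emb by (simp add: ix_less wt_eq_0_iff)

section \<open>Domain properties and divisibility transported along \<open>emb\<close>\<close>

lemma mpoly_mult_nonzero:
  fixes p q :: "('n, 'a::idom) mpoly"
  assumes "p \<noteq> 0" "q \<noteq> 0"
  shows "p * q \<noteq> 0"
proof -
  have "emb ix p * emb ix q \<noteq> 0" using assms by (simp add: emb_eq_0_iff)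
  then show ?thesis by (metis rhom.mult rhom.zero rhom_emb)
qed

lemma wt_mult':
  fixes p q :: "('n, 'a::idom) mpoly"
  assumes "p \<noteq> 0" "q \<noteq> 0"
  shows "wt c (p * q) = wt c p + wt c q"
proof -
  have "wt c r = wt (\<lambda>j. c (rx j)) (emb ix r)" for r :: "('n, 'a) mpoly"
    by (simp add: wt_emb rx_ix)
  then show ?thesis
    using assms by (simp add: rhom.mult[OF rhom_emb] wt_mult emb_eq_0_iff)
qed

lemma mpoly_prod_nonzero:
  fixes f :: "'b \<Rightarrow> ('n, 'a::idom) mpoly"
  shows "(\<And>i. i \<in> I \<Longrightarrow> f i \<noteq> 0) \<Longrightarrow> prod f I \<noteq> 0"
  by (induction I rule: infinite_finite_induct) (auto simp: mpoly_mult_nonzero)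

lemma wt_prod':
  fixes f :: "'b \<Rightarrow> ('n, 'a::idom) mpoly"
  shows "(\<And>i. i \<in> I \<Longrightarrow> f i \<noteq> 0) \<Longrightarrow> wt c (prod f I) = (\<Sum>i\<in>I. wt c (f i))"
  by (induction I rule: infinite_finite_induct) (auto simp: wt_mult' mpoly_prod_nonzero)

lemma mpoly_power_nonzero:
  fixes p :: "('n, 'a::idom) mpoly"
  shows "p \<noteq> 0 \<Longrightarrow> p ^ n \<noteq> 0"
  by (induction n) (auto simp: mpoly_mult_nonzero)

lemma wt_power':
  fixes p :: "('n, 'a::idom) mpoly"
  shows "p \<noteq> 0 \<Longrightarrow> wt c (p ^ n) = n * wt c p"
  by (induction n) (auto simp: wt_mult' mpoly_power_nonzero)

text \<open>By additivity of degrees a factor of a nonzero polynomial involves no new variables, so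
  it lies in the image of \<open>emb ix\<close>.\<close>

lemma emb_factor:
  fixes p :: "('n, 'a::idom) mpoly"
  assumes "c dvd emb ix p" "p \<noteq> 0"
  shows "\<exists>c'. c = emb ix c' \<and> c' dvd p"
proof -
  obtain d where d: "emb ix p = c * d" using assms(1) by (elim dvdE)
  have "c * d \<in> vars_below N" "c * d \<noteq> 0"
    using emb_vars_below[of p] assms(2) by (auto simp: emb_eq_0_iff simp flip: d)
  then have "c \<in> vars_below N" "d \<in> vars_below N"
    using vars_below_factor[of c d N] vars_below_factor[of d c N] by (auto simp: mult.commute)
  then have "emb ix p = emb ix (restr N rx c * restr N rx d)"
    by (simp add: d rhom.mult[OF rhom_emb] emb_restr)
  then have "p = restr N rx c * restr N rx d" by (rule emb_inj)
  then show ?thesis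
    using emb_restr[OF \<open>c \<in> vars_below N\<close>] by (intro exI[of _ "restr N rx c"]) auto
qed

lemma rel_prime_emb:
  fixes p q :: "('n, 'a::idom) mpoly"
  assumes "rel_prime p q" "p \<noteq> 0" "q \<noteq> 0"
  shows "rel_prime (emb ix p) (emb ix q)"
  unfolding rel_prime_def
proof (intro allI impI)
  fix c assume "c dvd emb ix p" "c dvd emb ix q"
  then obtain c' c'' where "c = emb ix c'" "c' dvd p" "c = emb ix c''" "c'' dvd q"
    using emb_factor assms by metis
  then have "c' dvd p" "c' dvd q" using emb_inj[of c' c''] by auto
  then have "c' dvd 1" using assms(1) by (auto simp: rel_prime_def)
  then show "c dvd 1" using \<open>c = emb ix c'\<close> rhom.dvd[OF rhom_emb, of c' 1 ix]
    by (simp add: rhom.one[OF rhom_emb])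
qed

lemma emb_unit_imp_const:
  fixes p :: "('n, 'a::field) mpoly"
  assumes "emb ix p dvd 1"
  shows "\<exists>c. c \<noteq> 0 \<and> p = const_poly c"
proof -
  have "wt (\<lambda>_. 1) p = 0" using tdeg.deg_unit[OF assms] by (simp add: wt_emb)
  then have p: "p = const_poly (Poly_Mapping.lookup p 0)" by (rule wt_0_imp_const)
  have "p \<noteq> 0" using assms by (auto simp: rhom.zero[OF rhom_emb])
  then have "Poly_Mapping.lookup p 0 \<noteq> 0" using p by (metis single_zero)
  with p show ?thesis by blast
qed

end

lemma numbering_exists:
  "\<exists>ix rx. numbering (ix :: 'n::finite \<Rightarrow> nat) rx (CARD('n))"
proof -
  obtain h where h: "bij_betw h (UNIV :: 'n set) {0..<CARD('n)}"
    using ex_bij_betw_finite_nat[of "UNIV :: 'n set"] by auto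
  have "numbering h (inv_into UNIV h) (CARD('n))"
  proof
    show "h i < CARD('n)" for i using bij_betwE[OF h] by simp
    show "inv_into UNIV h (h i) = i" for i using h by (simp add: bij_betw_def)
    show "h (inv_into UNIV h j) = j" if "j < CARD('n)" for j
      using bij_betw_inv_into_right[OF h, of j] that by simp
  qed
  then show ?thesis by blast
qed

subsection \<open>Irreducibility over a subfield\<close>

text \<open>Passes from factorizations over the large field to the subfield. A constant factor in
  \<open>K[x]\<close> is a unit there, since its inverse lies in \<open>K\<close>.\<close>

lemma ring_irreducible_poly_ring_over:
  fixes h :: "('n, 'a::field) mpoly"
  assumes K: "0 \<in> K" "\<And>c. c \<in> K \<Longrightarrow> inverse c \<in> K"
    and h: "h \<noteq> 0" "\<not> h dvd 1"
    and fac: "\<And>b c. h = b * c \<Longrightarrow>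
      (\<exists>\<beta>. \<beta> \<noteq> 0 \<and> b = const_poly \<beta>) \<or> (\<exists>\<gamma>. \<gamma> \<noteq> 0 \<and> c = const_poly \<gamma>)"
  shows "ring_irreducible\<^bsub>poly_ring_over K\<^esub> h"
proof -
  let ?R = "poly_ring_over K :: ('n, 'a) mpoly ring"
  have R: "carrier ?R = {p. range (Poly_Mapping.lookup p) \<subseteq> K}" "x \<otimes>\<^bsub>?R\<^esub> y = x * y"
    "\<one>\<^bsub>?R\<^esub> = 1" "\<zero>\<^bsub>?R\<^esub> = 0" for x y
    by (simp_all add: poly_ring_over_def ring_of_type_algebra_def)
  have inv: "const_poly (inverse c) \<in> carrier ?R" if "const_poly c \<in> carrier ?R" for c
  proof -
    have "Poly_Mapping.lookup (const_poly c :: ('n, 'a) mpoly) 0 \<in> K" using that unfolding R by blast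
    then have "inverse c \<in> K" using K by simp
    then show ?thesis using K unfolding R by (auto simp: lookup_single when_def)
  qed
  have "h \<notin> Units ?R"
    using h(2) by (auto simp: Units_def R) (metis dvd_triv_left)
  moreover have "b \<in> Units ?R" if b: "b \<in> carrier ?R" "properfactor ?R b h" for b
  proof -
    obtain c where c: "c \<in> carrier ?R" "h = b * c"
      using b(2) by (auto simp: properfactor_def factor_def R)
    from fac[OF c(2)] show ?thesis
    proof (elim disjE exE conjE)
      fix \<beta> assume \<beta>: "\<beta> \<noteq> 0" "b = const_poly \<beta>"
      then have "const_poly (inverse \<beta>) \<in> carrier ?R" using inv b(1) by simp
      moreover have "const_poly (inverse \<beta>) * b = 1" "b * const_poly (inverse \<beta>) = 1"
        using \<beta> by (simp_all add: mult_single)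
      ultimately show ?thesis using b(1) unfolding Units_def R(2,3) by blast
    next
      \<comment> \<open>With a constant cofactor, \<open>h\<close> divides \<open>b\<close>, so
        \<open>b\<close> is not a proper factor.\<close>
      fix \<gamma> assume \<gamma>: "\<gamma> \<noteq> 0" "c = const_poly \<gamma>"
      then have "const_poly (inverse \<gamma>) \<in> carrier ?R" using inv c(1) by simp
      moreover have "b = h * const_poly (inverse \<gamma>)"
        using \<gamma> by (simp add: c(2) mult.assoc mult_single)
      ultimately have "h divides\<^bsub>?R\<^esub> b" unfolding factor_def R(2) by blast
      with b(2) show ?thesis by (simp add: properfactor_def)
    qed
  qed
  ultimately show ?thesis
    using h(1) by (simp add: ring_irreducible_def Divisibility.irreducible_def R)
qed

lemma adjoin_closed:
  shows "0 \<in> adjoin a" "c \<in> adjoin a \<Longrightarrow> inverse c \<in> adjoin a"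
proof -
  let ?R = "ring_of_type_algebra :: 'a alg_closure ring"
  interpret R: field ?R by (rule field_from_type_algebra)
  show "0 \<in> adjoin a"
    unfolding adjoin_def by (rule generate_field.incl) (auto intro: rev_image_eqI[of 0])
  assume c: "c \<in> adjoin a"
  show "inverse c \<in> adjoin a"
  proof (cases "c = 0")
    case False
    have "inv\<^bsub>?R\<^esub> c = inverse c"
      using False by (intro R.comm_inv_char) (auto simp: ring_of_type_algebra_def)
    moreover have "inv\<^bsub>?R\<^esub> c \<in> adjoin a"
      using c False unfolding adjoin_def
      by (intro generate_field.m_inv) (auto simp: ring_of_type_algebra_def)
    ultimately show ?thesis by simp
  qed (use c in simp)
qed

subsection \<open>Comaximality\<close>

text \<open>Turns the equation of ideals into a Bezout relation, the form used from here on.\<close>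

lemma idl_sum_eq_UNIV:
  fixes a b :: "'a::comm_ring_1"
  assumes "Idl\<^bsub>ring_of_type_algebra\<^esub> {a} <+>\<^bsub>ring_of_type_algebra\<^esub> Idl\<^bsub>ring_of_type_algebra\<^esub> {b} = UNIV"
  shows "\<exists>x y. x * a + y * b = 1"
proof -
  let ?R = "ring_of_type_algebra :: 'a ring"
  interpret R: cring ?R by (rule cring_from_type_algebra)
  have "Idl\<^bsub>?R\<^esub> {x} = {y * x | y. True}" for x
    using R.cgenideal_eq_genideal[of x] by (simp add: cgenideal_def ring_of_type_algebra_def)
  then have "1 \<in> {y * a | y. True} <+>\<^bsub>?R\<^esub> {y * b | y. True}" using assms by simp
  then show ?thesis by (auto simp: AbelCoset.set_add_def set_mult_def ring_of_type_algebra_def)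
qed

text \<open>Multiply the Bezout relations: every term of the product except one contains
  \<open>a\<close>.\<close>

lemma comaximal_prod:
  fixes w :: "'b \<Rightarrow> 'a::comm_ring_1"
  assumes "\<And>i. i \<in> I \<Longrightarrow> \<exists>x y. x * a + y * w i = 1"
  shows "\<exists>x y. x * a + y * prod w I = 1"
  using assms
proof (induction I rule: infinite_finite_induct)
  case (insert i I)
  then obtain x y u v where 1: "x * a + y * w i = 1" "u * a + v * prod w I = 1" by (metis insertCI)
  have "1 = (x * a + y * w i) * (u * a + v * prod w I)" by (simp add: 1)
  also have "\<dots> = (x * (u * a + v * prod w I) + y * w i * u) * a + (y * v) * prod w (insert i I)"
    using insert.hyps by (simp add: algebra_simps)
  finally show ?case by (intro exI) (rule sym)
next
  \<comment> \<open>A product over an infinite set is 1 by convention.\<close>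
  case (infinite I)
  then show ?case by (intro exI[of _ 0] exI[of _ 1]) simp
next
  case empty
  then show ?case by (intro exI[of _ 0] exI[of _ 1]) simp
qed

lemma chinese_remainder:
  fixes w c :: "'b \<Rightarrow> 'a::comm_ring_1"
  assumes "finite I" "\<And>i j. \<lbrakk>i \<in> I; j \<in> I; i \<noteq> j\<rbrakk> \<Longrightarrow> \<exists>x y. x * w i + y * w j = 1"
  shows "\<exists>u. \<forall>i\<in>I. w i dvd u - c i"
  using assms
proof (induction I)
  case (insert k I)
  from insert.IH obtain u where u: "\<forall>i\<in>I. w i dvd u - c i" using insert.prems by blast
  obtain x y where xy: "x * w k + y * prod w I = 1"
    using comaximal_prod[of I "w k" w] insert.prems insert.hyps by (metis insertCI)
  \<comment> \<open>The factor \<open>y * prod w I\<close> is 1 modulo \<open>w k\<close> and 0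
    modulo the other \<open>w i\<close>, so only the residue at \<open>k\<close> is
    corrected.\<close>
  define u' where "u' = u + y * prod w I * (c k - u)"
  have "w i dvd u' - c i" if "i \<in> insert k I" for i
  proof (cases "i = k")
    case True
    have "u' - c k = (u - c k) * (1 - y * prod w I)" by (simp add: u'_def algebra_simps)
    also have "1 - y * prod w I = x * w k" using xy by (metis add_diff_cancel_right')
    finally show ?thesis using True by simp
  next
    case False
    then have "i \<in> I" using that by simp
    then have "w i dvd prod w I" using insert.hyps by (intro dvd_prodI) auto
    then have "w i dvd (u - c i) + y * prod w I * (c k - u)"
      using u \<open>i \<in> I\<close> by (intro dvd_add) auto
    then show ?thesis by (simp add: u'_def algebra_simps)
  qed
  then show ?case by blast
qed simp

subsection \<open>Irreducible values\<close>

text \<open>Variable 0 becomes the univariate variable itself. For the others, the roots of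
  \<open>x + y ^ e\<close> have degree at most 1, hence at most \<open>\<kappa>\<close>.\<close>

lemma good_twist_var:
  assumes "\<kappa> > 0" "\<And>i. e i > 0"
  shows "tdeg.good \<kappa> (twist e (var i :: (nat, 'a::field) mpoly))"
proof (cases i)
  case 0
  show ?thesis unfolding 0 twist_var_0 tdeg.good_def tdeg.weight_le_def tdeg.deg_le_def
    by (auto simp: coeff_pCons split: nat.splits)
next
  case (Suc j)
  let ?f = "[:var j:] + monom 1 (e j) :: (nat, 'a) mpoly poly"
  have less: "degree [:var j :: (nat, 'a) mpoly:] < degree (monom (1 :: (nat, 'a) mpoly) (e j))"
    using assms(2) by (simp add: degree_monom_eq)
  have deg: "degree ?f = e j"
    unfolding degree_add_eq_right[OF less] by (simp add: degree_monom_eq)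
  have lead: "lead_coeff ?f = 1"
    unfolding lead_coeff_add_le[OF less] by (simp add: degree_monom_eq)
  have "wt (\<lambda>_. 1) (coeff ?f k) + \<kappa> * k \<le> \<kappa> * e j" if "coeff ?f k \<noteq> 0" for k
  proof -
    from that consider "k = 0" | "k = e j" "k \<noteq> 0"
      by (cases k) (auto split: if_splits)
    then show ?thesis
    proof cases
      case 1
      then have "coeff ?f k = var j" using assms(2)[of j] by simp
      then show ?thesis using 1 assms by (simp add: Suc_le_eq)
    next
      case 2
      then have "coeff ?f k = 1" using lead deg by simp
      then show ?thesis using 2 by simp
    qed
  qed
  then show ?thesis
    unfolding Suc twist_var_Suc tdeg.good_def tdeg.weight_le_def tdeg.deg_le_def using deg lead by simp
qed

lemma var_nonzero: "var i \<noteq> (0 :: ('i, 'a::comm_ring_1) mpoly)"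
  unfolding var_def by (metis lookup_single_eq lookup_zero zero_neq_one)

text \<open>\<open>S\<close> and \<open>T\<close> are fixed before \<open>Z\<close>, so the
  exponents of \<open>Z\<close> stay free for prescribing degrees. The factorizations are over the
  algebraic closure.\<close>

theorem (in numbering) irreducible_family:
  fixes P Q :: "'b \<Rightarrow> ('n, 'k::field) mpoly"
  assumes N: "N \<ge> 2" and I: "finite I"
    and PQ: "\<And>i. i \<in> I \<Longrightarrow> P i \<noteq> 0" "\<And>i. i \<in> I \<Longrightarrow> Q i \<noteq> 0"
      "\<And>i. i \<in> I \<Longrightarrow> rel_prime (emb ix (P i)) (emb ix (Q i))"
  shows "\<exists>S T. S \<noteq> 0 \<and> T \<noteq> 0 \<and> (\<forall>Z f i b c. Z = (\<Prod>j\<in>UNIV. var j ^ f j) \<longrightarrow>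
    (\<forall>j. f j > (0::nat)) \<longrightarrow> i \<in> I \<longrightarrow> to_ac_poly (P i + (1 + S * Z) * T * Q i) = b * c \<longrightarrow>
    emb ix b dvd 1 \<or> emb ix c dvd 1)"
proof -
  define S where "S = prod P I"
  have S0: "S \<noteq> 0" unfolding S_def using PQ(1) by (rule mpoly_prod_nonzero)
  define F where "F = insert (emb ix (to_ac_poly S)) ((\<lambda>i. emb ix (to_ac_poly (Q i))) ` I)"
  have "0 \<notin> F" using S0 PQ(2) by (auto simp: F_def emb_eq_0_iff to_ac_poly_eq_0_iff)
  moreover have finF: "finite F" using I by (simp add: F_def)
  ultimately obtain e where e: "\<And>i. e i > 0" "\<And>p. p \<in> F \<Longrightarrow> lead_coeff (twist e p) dvd 1"
    using noether_normalization[of F] by blast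
  define \<Psi> where "\<Psi> p = twist e (emb ix (to_ac_poly p))" for p :: "('n, 'k) mpoly"
  have \<Psi>: "rhom \<Psi>"
    unfolding \<Psi>_def by (intro rhom_comp[OF rhom_twist rhom_comp[OF rhom_emb rhom_to_ac_poly]])
  interpret \<Psi>: rhom \<Psi> by (rule \<Psi>)
  have \<Psi>0: "\<Psi> p = 0 \<longleftrightarrow> p = 0" for p
    by (simp add: \<Psi>_def twist_eq_0_iff emb_eq_0_iff to_ac_poly_eq_0_iff)
  have "\<forall>p\<in>F. \<exists>\<kappa>. tdeg.good \<kappa> (twist e p)" using e(2) tdeg.good_exists by blast
  then obtain \<kappa>' where \<kappa>': "\<And>p. p \<in> F \<Longrightarrow> tdeg.good (\<kappa>' p) (twist e p)" by metis
  \<comment> \<open>One slope for all of \<open>F\<close>; \<open>Suc\<close> makes it positive, as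
    \<open>good_twist_var\<close> requires for the variables in \<open>Z\<close>.\<close>
  define \<kappa> where "\<kappa> = Suc (sum \<kappa>' F)"
  have good: "tdeg.good \<kappa> (twist e p)" if "p \<in> F" for p
    by (rule tdeg.good_mono[OF \<kappa>'[OF that]])
      (use member_le_sum[of p F \<kappa>'] finF that in \<open>simp add: \<kappa>_def\<close>)
  have good_S: "tdeg.good \<kappa> (\<Psi> S)" unfolding \<Psi>_def by (rule good) (simp add: F_def)
  have good_Q: "tdeg.good \<kappa> (\<Psi> (Q i))" if "i \<in> I" for i
    unfolding \<Psi>_def using that by (intro good) (simp add: F_def)
  have "\<forall>i. \<exists>C. tdeg.weight_le \<kappa> C (\<Psi> (P i))" using tdeg.weight_le_exists by blast
  then obtain C' where C': "\<And>i. tdeg.weight_le \<kappa> (C' i) (\<Psi> (P i))" by metis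
  define C where "C = sum C' I"
  have C: "tdeg.weight_le \<kappa> C (\<Psi> (P i))" if "i \<in> I" for i
    using C'[of i] by (rule tdeg.weight_le_mono) (use member_le_sum[of i I C'] I that in \<open>simp add: C_def\<close>)
  \<comment> \<open>Larger than both bounds in \<open>linear_factor_irreducible\<close>. Neither of
    them depends on \<open>Z\<close>.\<close>
  define \<alpha> where "\<alpha> = Suc (\<kappa> + C)"
  define y0 where "y0 = rx 0"
  define y1 where "y1 = rx 1"
  have ix_y: "ix y0 = 0" "ix y1 = Suc 0" using N ix_rx[of 0] ix_rx[of 1] by (auto simp: y0_def y1_def)
  have \<Psi>_var: "\<Psi> (var j) = twist e (var (ix j))" for j
    by (simp add: \<Psi>_def to_ac_poly_var emb_var)
  define s where "s = (var 0 ^ \<alpha> :: (nat, 'k alg_closure) mpoly)"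
  have s0: "s \<noteq> 0" by (simp add: s_def var_nonzero)
  have wt_s: "wt (\<lambda>_. 1) s = \<alpha>" by (simp add: s_def wt_power var_nonzero)
  \<comment> \<open>A preimage of \<open>[:s, 1:]\<close> with coefficients in the ground field:
    \<open>var y1\<close> becomes the variable in \<open>s\<close> plus \<open>y ^ e 0\<close>, and
    the subtraction removes that power of \<open>y\<close>.\<close>
  define T where "T = (var y0 + (var y1 - var y0 ^ e 0) ^ \<alpha> :: ('n, 'k) mpoly)"
  have "[:var 0 :: (nat, 'k alg_closure) mpoly:] ^ \<alpha> = [:s:]"
    unfolding s_def by (rule rhom.power[OF rhom_pCons, symmetric])
  then have \<Psi>_T: "\<Psi> T = [:s, 1:]"
    unfolding T_def \<Psi>.add \<Psi>.power \<Psi>.diff \<Psi>_var ix_y twist_var_0 twist_var_Suc monom_1_eq by simp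
  have T0: "T \<noteq> 0" using \<Psi>_T \<Psi>0[of T] by auto
  have main: "emb ix b dvd 1 \<or> emb ix c dvd 1"
    if Z: "Z = (\<Prod>j\<in>UNIV. var j ^ f j)" and f: "\<forall>j. f j > (0::nat)" and i: "i \<in> I"
      and bc: "to_ac_poly (P i + (1 + S * Z) * T * Q i) = b * c" for Z f i b c
  proof -
    \<comment> \<open>Finiteness of the index type comes from the numbering.\<close>
    have "(UNIV :: 'n set) \<subseteq> rx ` {..<N}"
      using ix_less rx_ix by (metis image_eqI lessThan_iff subsetI)
    then have fin: "finite (UNIV :: 'n set)" by (rule finite_subset) simp
    have \<Psi>_X: "\<Psi> Z = (\<Prod>j\<in>UNIV. \<Psi> (var j) ^ f j)"
      by (simp add: Z \<Psi>.prod \<Psi>.power)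
    have good_X: "tdeg.good \<kappa> (\<Psi> Z)"
      unfolding \<Psi>_X \<Psi>_var
      by (intro tdeg.good_prod tdeg.good_power good_twist_var e(1)) (simp add: \<kappa>_def)
    \<comment> \<open>\<open>var y0\<close> becomes \<open>y\<close> and occurs in \<open>Z\<close>,
      so \<open>\<Psi> Z\<close> has positive degree and adding 1 to
      \<open>\<Psi> S * \<Psi> Z\<close> leaves its leading coefficient alone.\<close>
    have "degree (\<Psi> (var y0) ^ f y0) \<le> (\<Sum>j\<in>UNIV. degree (\<Psi> (var j) ^ f j))"
      by (rule member_le_sum[of y0 _ "\<lambda>j. degree (\<Psi> (var j) ^ f j)"])
        (use fin N in \<open>auto simp: ix_y\<close>)
    also have "\<dots> = degree (\<Psi> Z)"
      unfolding \<Psi>_X by (rule degree_prod_sum_eq[symmetric]) (simp add: \<Psi>0 var_nonzero)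
    finally have degX: "degree (\<Psi> Z) > 0"
      using f by (simp add: \<Psi>_var ix_y twist_var_0 degree_power_eq) (metis Suc_le_eq le_trans)
    have nz: "\<Psi> S \<noteq> 0" "\<Psi> Z \<noteq> 0" using good_S good_X tdeg.good_nonzero by blast+
    have deg_SX: "degree (\<Psi> S * \<Psi> Z) = degree (\<Psi> S) + degree (\<Psi> Z)"
      using nz by (rule degree_mult_eq)
    have good_SX: "tdeg.good \<kappa> (1 + \<Psi> S * \<Psi> Z)"
      using tdeg.good_mult[OF good_S good_X] degX deg_SX by (intro tdeg.good_1_plus) auto
    have PS: "\<Psi> (P i) dvd \<Psi> S" unfolding S_def using i I by (intro \<Psi>.dvd dvd_prodI)
    let ?Q = "\<Psi> (Q i) * (1 + \<Psi> S * \<Psi> Z)"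
    have "degree (\<Psi> (P i)) \<le> degree (\<Psi> S)" using PS nz by (intro dvd_imp_degree_le)
    also have "\<dots> \<le> degree (1 + \<Psi> S * \<Psi> Z)"
      using degX deg_SX by (subst degree_add_eq_right) auto
    also have "\<dots> \<le> degree ?Q"
      using good_Q[OF i] good_SX by (simp add: degree_mult_eq tdeg.good_nonzero)
    finally have degP: "degree (\<Psi> (P i)) \<le> degree ?Q" .
    \<comment> \<open>A divisor of \<open>\<Psi> (P i)\<close> divides \<open>\<Psi> S\<close>, so
      \<open>1 + \<Psi> S * \<Psi> Z\<close> is 1 modulo \<open>g\<close> and only
      \<open>\<Psi> (Q i)\<close> remains.\<close>
    have cop: "g dvd 1" if g: "g dvd \<Psi> (P i)" "g dvd ?Q" for g
    proof -
      have "g dvd \<Psi> (Q i) * (\<Psi> S * \<Psi> Z)" using g(1) PS by (meson dvd_mult dvd_mult2 dvd_trans)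
      with g(2) have "g dvd \<Psi> (Q i)" by (simp add: distrib_left dvd_add_left_iff)
      then have "untwist e g dvd to_ac_poly (emb ix (P i))" "untwist e g dvd to_ac_poly (emb ix (Q i))"
        using g(1) twist_dvd_iff[of e "untwist e g"]
        by (auto simp: twist_untwist \<Psi>_def emb_to_ac_poly)
      then have "untwist e g dvd 1"
        using rel_prime_alg_closure[OF PQ(3)[OF i]] PQ(2)[OF i] by (simp add: emb_eq_0_iff)
      then show ?thesis using twist_unit_iff[of e "untwist e g"] by (simp add: twist_untwist)
    qed
    have "\<Psi> (P i) + ?Q * [:s, 1:] = \<Psi> (P i + (1 + S * Z) * T * Q i)"
      unfolding \<Psi>.add \<Psi>.mult \<Psi>.one \<Psi>_T by (simp only: mult_ac)
    also have "\<dots> = twist e (emb ix b) * twist e (emb ix c)"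
      unfolding \<Psi>_def bc by (simp add: rhom.mult[OF rhom_emb] rhom.mult[OF rhom_twist])
    finally have fac: "\<Psi> (P i) + ?Q * [:s, 1:] = twist e (emb ix b) * twist e (emb ix c)" .
    have "\<kappa> < wt (\<lambda>_. 1) s" "C < wt (\<lambda>_. 1) s" unfolding wt_s \<alpha>_def by simp_all
    from tdeg.linear_factor_irreducible[OF tdeg.good_mult[OF good_Q[OF i] good_SX] C[OF i] degP s0 this cop fac]
    show ?thesis by (simp add: twist_unit_iff)
  qed
  show ?thesis
    by (rule exI[of _ S], rule exI[of _ T]) (use S0 T0 main in blast)
qed

text \<open>A common irreducible factor of \<open>P i\<close> and the product divides some
  \<open>w j\<close>, hence \<open>u - a i V\<close> and \<open>u - a j V\<close>. Their difference
  is a nonzero constant times \<open>V\<close>, which contradicts that \<open>w j\<close> and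
  \<open>V\<close> are relatively prime.\<close>

theorem (in numbering) coprime_cofactors:
  fixes w :: "'b \<Rightarrow> ('n, 'k::field) mpoly" and a :: "'b \<Rightarrow> 'k"
  assumes I: "finite I" "inj_on a I" and V: "V \<noteq> 0"
    and w: "\<And>i. i \<in> I \<Longrightarrow> w i \<noteq> 0" "\<And>i. i \<in> I \<Longrightarrow> rel_prime (w i) V"
    and comax: "\<And>i j. \<lbrakk>i \<in> I; j \<in> I; i \<noteq> j\<rbrakk> \<Longrightarrow> \<exists>x y. x * w i + y * w j = 1"
  shows "\<exists>u P. \<forall>i\<in>I. u - const_poly (a i) * V = w i * P i \<and> P i \<noteq> 0 \<and>
    rel_prime (emb ix (P i)) (emb ix (\<Prod>j\<in>I-{i}. w j))"
proof -
  define W where "W = prod w I"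
  define Q where "Q i = prod w (I - {i})" for i
  have W: "W = w i * Q i" if "i \<in> I" for i
    unfolding W_def Q_def using I that by (simp add: prod.remove)
  have Q0: "Q i \<noteq> 0" for i unfolding Q_def using w(1) by (intro mpoly_prod_nonzero) auto
  obtain u0 where "\<forall>i\<in>I. w i dvd u0 - const_poly (a i) * V"
    using chinese_remainder[of I w "\<lambda>i. const_poly (a i) * V", OF I(1) comax] by blast
  then obtain P0 where P0: "\<And>i. i \<in> I \<Longrightarrow> u0 - const_poly (a i) * V = w i * P0 i"
    unfolding dvd_def by metis
  define c :: "'n \<Rightarrow> nat" where "c = (\<lambda>_. 1)"
  \<comment> \<open>Adding \<open>W * z\<close> keeps all congruences, and a \<open>z\<close> of
    degree above every \<open>P0 i\<close> makes each \<open>P i\<close> nonzero.\<close>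
  define k where "k = Suc (\<Sum>i\<in>I. wt c (P0 i))"
  define z where "z = (var (rx 0) ^ k :: ('n, 'k) mpoly)"
  have z: "z \<noteq> 0" "wt c z = k"
    by (simp_all add: z_def c_def mpoly_power_nonzero wt_power' var_nonzero)
  define u where "u = u0 + W * z"
  define P where "P i = P0 i + Q i * z" for i
  have uP: "u - const_poly (a i) * V = w i * P i" if "i \<in> I" for i
    using P0[OF that] W[OF that] by (simp add: u_def P_def algebra_simps)
  have P_nz: "P i \<noteq> 0" if "i \<in> I" for i
  proof -
    have "wt c (P0 i) < k"
      using member_le_sum[of i I "\<lambda>i. wt c (P0 i)"] I that by (simp add: k_def)
    also have "k \<le> wt c (Q i * z)" using Q0 z by (simp add: wt_mult')
    finally have "wt c (P0 i) < wt c (Q i * z)" .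
    from wt_add_eq[OF this] this have "wt c (P i) > 0" by (simp add: P_def add.commute)
    then show ?thesis using wt_const[of c "0::'k"] by auto
  qed
  have "rel_prime (emb ix (P i)) (emb ix (Q i))" if i: "i \<in> I" for i
  proof -
    have "\<not> (\<pi> dvd emb ix (P i) \<and> \<pi> dvd emb ix (Q i))" if \<pi>: "Factorial_Ring.irreducible \<pi>" for \<pi>
    proof
      assume *: "\<pi> dvd emb ix (P i) \<and> \<pi> dvd emb ix (Q i)"
      then have "\<pi> dvd (\<Prod>j\<in>I-{i}. emb ix (w j))" by (simp add: Q_def rhom.prod[OF rhom_emb])
      from irreducible_dvd_prod[OF \<pi> this] obtain j where j: "j \<in> I" "j \<noteq> i" "\<pi> dvd emb ix (w j)"
        by auto
      have "\<pi> dvd emb ix (u - const_poly (a i) * V)" "\<pi> dvd emb ix (u - const_poly (a j) * V)"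
        using * j uP[OF i] uP[OF j(1)] by (simp_all add: rhom.mult[OF rhom_emb])
      then have "\<pi> dvd emb ix (u - const_poly (a i) * V) - emb ix (u - const_poly (a j) * V)"
        by (rule dvd_diff)
      also have "\<dots> = const_poly (a j - a i) * emb ix V"
        by (simp add: rhom.diff[OF rhom_emb] rhom.mult[OF rhom_emb] emb_const left_diff_distrib single_diff)
      finally have "\<pi> dvd const_poly (a j - a i) * emb ix V" .
      moreover have "a j - a i \<noteq> 0" using I(2) i j by (auto dest: inj_onD)
      then have "\<not> \<pi> dvd const_poly (a j - a i)"
        using \<pi> const_poly_unit by (metis Factorial_Ring.irreducible_not_unit dvd_trans)
      ultimately have "\<pi> dvd emb ix V" using irreducible_imp_prime_mpoly[OF \<pi>] by blast
      moreover have "rel_prime (emb ix (w j)) (emb ix V)" using w j V by (intro rel_prime_emb) auto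
      ultimately have "\<pi> dvd 1" using j by (simp add: rel_prime_def)
      then show False using \<pi> by (simp add: Factorial_Ring.irreducible_def)
    qed
    then show ?thesis
      using P_nz[OF i] by (subst rel_prime_iff_no_irreducible) (auto simp: emb_eq_0_iff)
  qed
  with uP P_nz show ?thesis unfolding Q_def by blast
qed

section \<open>Degree comparisons and the construction of \<open>U\<close>\<close>

lemma wt_mono:
  assumes "\<And>i. c i \<le> c' i"
  shows "wt c p \<le> wt c' p"
proof -
  have "wexp c m \<le> wexp c' m" for m
    unfolding wexp_def by (intro sum_mono mult_right_mono assms) simp
  moreover have "\<forall>m\<in>Poly_Mapping.keys p. wexp c' m \<le> wt c' p" by (simp flip: wt_le_iff)
  ultimately show ?thesis unfolding wt_le_iff using le_trans by blast
qed

lemma degree_in_le_total_degree: "degree_in i p \<le> total_degree p"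
  for p :: "('n::finite, 'a::comm_ring_1) mpoly"
  unfolding degree_in_eq_wt total_degree_eq_wt by (rule wt_mono) simp

lemma wt_const_mult_le: "wt c (const_poly b * p) \<le> wt c p"
proof -
  have "Poly_Mapping.keys (const_poly b * p) \<subseteq> Poly_Mapping.keys p"
    using keys_mult[of "const_poly b" p] by (auto split: if_splits)
  moreover have "\<forall>m\<in>Poly_Mapping.keys p. wexp c m \<le> wt c p" by (simp flip: wt_le_iff)
  ultimately show ?thesis unfolding wt_le_iff by blast
qed

theorem corollary1p6:
  fixes t :: nat
    and a :: "nat \<Rightarrow> 'k::field"
    and a0 :: "'k alg_closure"
    and V :: "('n::finite, 'k) mpoly"
    and w :: "nat \<Rightarrow> ('n, 'k) mpoly"
  assumes "CARD('n) \<ge> 2"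
    and "inj_on a {1..t}"
    and "a0 \<notin> to_ac ` a ` {1..t}"
    and "separable_element a0"
    and "V \<noteq> 0"
    and "\<And>i. i \<le> t \<Longrightarrow> w i \<noteq> 0"
    and "w 0 = 1"
    and "\<And>i j. i \<le> t \<Longrightarrow> j \<le> t \<Longrightarrow> i \<noteq> j \<Longrightarrow>
      Idl\<^bsub>ring_of_type_algebra\<^esub> {w i} <+>\<^bsub>ring_of_type_algebra\<^esub> Idl\<^bsub>ring_of_type_algebra\<^esub> {w j} = UNIV"
    and "\<And>i. i \<le> t \<Longrightarrow> rel_prime (w i) V"
  shows "\<exists>d0::nat. \<forall>d :: 'n \<Rightarrow> nat. (\<forall>i. d i > d0) \<longrightarrow>
    (\<exists>U :: ('n, 'k) mpoly.
      (\<forall>i\<in>{1..t}. \<exists>H :: ('n, 'k) mpoly.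
          U - const_poly (a i) * V = w i * H \<and>
          ring_irreducible\<^bsub>poly_ring_over (adjoin a0)\<^esub> (to_ac_poly H) \<and>
          \<not> H dvd w i) \<and>
      total_degree (to_ac_poly U - const_poly a0 * to_ac_poly V) =
        max (total_degree U) (total_degree V) \<and>
      (\<forall>i. degree_in i U = d i))"
proof -
  obtain ix rx where "numbering (ix :: 'n \<Rightarrow> nat) rx (CARD('n))" using numbering_exists by blast
  then interpret numbering ix rx "CARD('n)" .
  define I where "I = {1..t}"
  define Q where "Q i = prod w (I - {i})" for i
  define W where "W = prod w I"
  have W: "W = w i * Q i" if "i \<in> I" for i
    unfolding W_def Q_def using that by (simp add: prod.remove I_def)
  have w0: "w i \<noteq> 0" if "i \<in> I" for i using that assms(6) by (simp add: I_def)
  have W0: "W \<noteq> 0" unfolding W_def using w0 by (rule mpoly_prod_nonzero)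
  have Q0: "Q i \<noteq> 0" for i unfolding Q_def using w0 by (intro mpoly_prod_nonzero) auto
  have comax: "\<exists>x y. x * w i + y * w j = 1" if "i \<in> I" "j \<in> I" "i \<noteq> j" for i j
    using that by (intro idl_sum_eq_UNIV assms(8)) (auto simp: I_def)
  have "finite I" "inj_on a I" "\<And>i. i \<in> I \<Longrightarrow> rel_prime (w i) V"
    using assms(2,9) by (auto simp: I_def)
  from coprime_cofactors[where w = w, OF this(1,2) assms(5) w0 this(3) comax] obtain u P where
    "\<forall>i\<in>I. u - const_poly (a i) * V = w i * P i \<and> P i \<noteq> 0 \<and>
      rel_prime (emb ix (P i)) (emb ix (Q i))"
    unfolding Q_def by blast
  then have P: "\<And>i. i \<in> I \<Longrightarrow> u - const_poly (a i) * V = w i * P i"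
      "\<And>i. i \<in> I \<Longrightarrow> P i \<noteq> 0" "\<And>i. i \<in> I \<Longrightarrow> rel_prime (emb ix (P i)) (emb ix (Q i))"
    by blast+
  from irreducible_family[of I P Q] assms(1) P Q0 obtain S T where ST: "S \<noteq> 0" "T \<noteq> 0"
    "\<And>Z f i b c. \<lbrakk>Z = (\<Prod>j\<in>UNIV. var j ^ f j); \<forall>j. f j > 0; i \<in> I;
      to_ac_poly (P i + (1 + S * Z) * T * Q i) = b * c\<rbrakk> \<Longrightarrow> emb ix b dvd 1 \<or> emb ix c dvd 1"
    by (auto simp: I_def)
  \<comment> \<open>The summands make the exponents \<open>f i\<close> positive, let
    \<open>A * W\<close> dominate \<open>u\<close> and \<open>V\<close>, and, through the factor 2,
    make \<open>H\<close> larger in degree than \<open>w i\<close>.\<close>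
  define bnd where "bnd i = degree_in i S + degree_in i T + degree_in i W + degree_in i u +
    2 * (\<Sum>j\<in>I. degree_in i (w j)) + total_degree V" for i
  show ?thesis
  \<comment> \<open>The sum is one bound for all variables.\<close>
  proof (rule exI[of _ "sum bnd UNIV"], intro allI impI)
    fix d :: "'n \<Rightarrow> nat" assume "\<forall>i. sum bnd UNIV < d i"
    then have d: "bnd i < d i" for i
      using member_le_sum[of i UNIV bnd] by (metis UNIV_I finite le_less_trans zero_le)
    \<comment> \<open>The exponent that gives \<open>A * W\<close> degree exactly \<open>d i\<close>
      in variable \<open>i\<close>; by the choice of \<open>bnd\<close> no subtraction
      truncates.\<close>
    define f where "f i = d i - degree_in i S - degree_in i T - degree_in i W" for i
    have f: "f i > 0" "degree_in i S + f i + degree_in i T + degree_in i W = d i" for i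
      using d[of i] by (auto simp: f_def bnd_def)
    define Z where "Z = (\<Prod>j\<in>UNIV. var j ^ f j :: ('n, 'k) mpoly)"
    have Z0: "Z \<noteq> 0"
      unfolding Z_def by (intro mpoly_prod_nonzero mpoly_power_nonzero var_nonzero)
    have deg_Z: "degree_in i Z = f i" for i
    proof -
      have "degree_in i Z = (\<Sum>j\<in>UNIV. f j * (if j = i then 1 else 0))"
        unfolding Z_def degree_in_eq_wt
        by (subst wt_prod') (simp_all add: mpoly_power_nonzero var_nonzero wt_power')
      then show ?thesis by (simp add: if_distrib cong: if_cong)
    qed
    define A where "A = (1 + S * Z) * T"
    have deg_SZ: "degree_in i (S * Z) = degree_in i S + f i" for i
      using deg_Z[of i] ST(1) Z0 by (simp add: degree_in_eq_wt wt_mult')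
    have deg_B: "degree_in i (1 + S * Z) = degree_in i S + f i" for i
    proof -
      have "degree_in i (S * Z + 1) = degree_in i (S * Z)"
        using f(1)[of i] deg_SZ[of i] unfolding degree_in_eq_wt by (intro wt_add_eq) simp
      then show ?thesis by (simp add: deg_SZ add.commute)
    qed
    have B0: "1 + S * Z \<noteq> 0"
    proof
      assume "1 + S * Z = 0"
      then have "degree_in i (1 + S * Z) = 0" for i by (simp add: degree_in_def)
      then show False using deg_B f(1) by simp
    qed
    have A0: "A \<noteq> 0" unfolding A_def using B0 ST(2) by (rule mpoly_mult_nonzero)
    have deg_AW: "degree_in i (A * W) = d i" for i
      using deg_B[of i] f(2)[of i] B0 ST(2) A0 W0
      by (simp add: degree_in_eq_wt wt_mult' A_def)
    define U where "U = u + A * W"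
    have deg_U: "degree_in i U = d i" for i
    proof -
      have "degree_in i u < degree_in i (A * W)" using d[of i] by (simp add: deg_AW bnd_def)
      then have "degree_in i (A * W + u) = degree_in i (A * W)"
        unfolding degree_in_eq_wt by (rule wt_add_eq)
      then show ?thesis by (simp add: U_def deg_AW add.commute)
    qed
    have degV: "total_degree V < d i" for i using d[of i] by (simp add: bnd_def)
    have "\<exists>H. U - const_poly (a i) * V = w i * H \<and>
        ring_irreducible\<^bsub>poly_ring_over (adjoin a0)\<^esub> (to_ac_poly H) \<and> \<not> H dvd w i" if i: "i \<in> I" for i
    proof -
      define H where "H = P i + A * Q i"
      have UH: "U - const_poly (a i) * V = w i * H"
        using P(1)[OF i] W[OF i] by (simp add: U_def H_def algebra_simps)
      have deg_wH: "degree_in j (w i * H) = d j" for j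
      proof -
        have "degree_in j (const_poly (a i) * V) \<le> degree_in j V"
          unfolding degree_in_eq_wt by (rule wt_const_mult_le)
        also have "\<dots> \<le> total_degree V" by (rule degree_in_le_total_degree)
        also have "\<dots> < degree_in j U" using degV deg_U by simp
        finally show ?thesis
          unfolding UH[symmetric] deg_U[symmetric, of j] degree_in_eq_wt by (rule wt_diff_eq)
      qed
      \<comment> \<open>Any variable serves to compare degrees.\<close>
      obtain j :: 'n where True by blast
      have H0: "H \<noteq> 0" using deg_wH[of j] degV[of j] by (auto simp: degree_in_def)
      have "degree_in j (w i) \<le> (\<Sum>k\<in>I. degree_in j (w k))"
        using i by (intro member_le_sum) (auto simp: I_def)
      \<comment> \<open>The degrees of \<open>w i\<close> and \<open>H\<close> in variable
        \<open>j\<close> add up to \<open>d j\<close>, so \<open>H\<close> has the larger one and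
        cannot divide \<open>w i\<close>.\<close>
      then have "2 * degree_in j (w i) < d j" using d[of j] by (simp add: bnd_def)
      then have deg_H: "degree_in j (w i) < degree_in j H"
        using deg_wH[of j] w0[OF i] H0 by (simp add: degree_in_eq_wt wt_mult')
      have "\<not> H dvd w i"
      proof
        assume "H dvd w i"
        then obtain r where r: "w i = H * r" by (elim dvdE)
        then have "r \<noteq> 0" using w0[OF i] by auto
        then have "degree_in j H \<le> degree_in j (w i)"
          using H0 by (simp add: r degree_in_eq_wt wt_mult')
        with deg_H show False by simp
      qed
      moreover have "ring_irreducible\<^bsub>poly_ring_over (adjoin a0)\<^esub> (to_ac_poly H)"
      proof (rule ring_irreducible_poly_ring_over)
        show "to_ac_poly H \<noteq> 0" using H0 by (simp add: to_ac_poly_eq_0_iff)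
        show "\<not> to_ac_poly H dvd 1"
        proof
          assume "to_ac_poly H dvd 1"
          then have "emb ix (to_ac_poly H) dvd 1"
            using rhom.dvd[OF rhom_emb, of _ 1] by (simp add: rhom.one[OF rhom_emb])
          then obtain c where "to_ac_poly H = const_poly c" using emb_unit_imp_const by blast
          \<comment> \<open>A constant has degree 0 for all weights, whereas \<open>H\<close> has
            positive degree in variable \<open>j\<close>.\<close>
          then have "wt c' (to_ac_poly H) = 0" for c' by simp
          then have "wt c' H = 0" for c' by (simp add: wt_eq_Max keys_to_ac_poly)
          then show False using deg_H by (simp add: degree_in_eq_wt)
        qed
        fix b c assume "to_ac_poly H = b * c"
        then have "emb ix b dvd 1 \<or> emb ix c dvd 1"
          using ST(3)[OF Z_def _ i] f(1) unfolding H_def A_def by blast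
        then show "(\<exists>\<beta>. \<beta> \<noteq> 0 \<and> b = const_poly \<beta>) \<or> (\<exists>\<gamma>. \<gamma> \<noteq> 0 \<and> c = const_poly \<gamma>)"
          using emb_unit_imp_const by blast
      qed (auto intro: adjoin_closed)
      ultimately show ?thesis using UH by blast
    qed
    moreover have "total_degree (to_ac_poly U - const_poly a0 * to_ac_poly V) =
      max (total_degree U) (total_degree V)"
    proof -
      obtain j :: 'n where True by blast
      \<comment> \<open>Already one \<open>d j\<close> exceeds the degree of \<open>V\<close>, so
        subtracting \<open>a0 V\<close> cannot lower the degree of \<open>U\<close>.\<close>
      have less: "total_degree V < total_degree U"
        using degV[of j] deg_U[of j] degree_in_le_total_degree[of j U] by simp
      have ac: "total_degree (to_ac_poly p) = total_degree p" for p :: "('n, 'k) mpoly"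
        by (simp add: total_degree_def keys_to_ac_poly)
      have "total_degree (const_poly a0 * to_ac_poly V) \<le> total_degree (to_ac_poly V)"
        unfolding total_degree_eq_wt by (rule wt_const_mult_le)
      also have "\<dots> < total_degree (to_ac_poly U)" using less by (simp add: ac)
      finally have "total_degree (to_ac_poly U - const_poly a0 * to_ac_poly V) = total_degree (to_ac_poly U)"
        unfolding total_degree_eq_wt by (rule wt_diff_eq)
      with less show ?thesis by (simp add: ac)
    qed
    ultimately show "\<exists>U :: ('n, 'k) mpoly.
      (\<forall>i\<in>{1..t}. \<exists>H :: ('n, 'k) mpoly.
          U - const_poly (a i) * V = w i * H \<and>
          ring_irreducible\<^bsub>poly_ring_over (adjoin a0)\<^esub> (to_ac_poly H) \<and>
          \<not> H dvd w i) \<and>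
      total_degree (to_ac_poly U - const_poly a0 * to_ac_poly V) =
        max (total_degree U) (total_degree V) \<and>
      (\<forall>i. degree_in i U = d i)"
      using deg_U unfolding I_def by (intro exI[of _ U]) blast
  qed
qed

end
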